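(* Let $A$ be an associative ring with unit and let $X,X'$ be two homotopically equivalent graded complexes of left $A$-modules (with differentials of degree $-1$). Let $Y=\mathrm{End}_A(X)$ and $Y'=\mathrm{End}_A(X')$ be their endomorphism complexes. Then $$H^*(Y)\simeq H^*(Y')$$ as graded associative algebras.
   Context: For a complex $X=\{X^p\}_{p\in\mathbb{Z}}$ of left $A$-modules with differential $d:X^p\to X^{p-1}$, $d^2=0$, the graded algebra $Y=\mathrm{End}_A(X)$ is $Y=\bigoplus_{n\in\mathbb{Z}}Y^n$ with $Y^n=\prod_{p+q=n}Y^{p,q}$ and $Y^{p,q}=\mathrm{Hom}_A(X^p,X^{-q})$. Thus an element of degree $n$ is a family of $A$-linear maps $X^p\to X^{p-n}$, $p\in\mathbb{Z}$. The product is composition. The differential $\mathbf{d}$ of degree $+1$ is defined on homogeneous $f$ by $\mathbf{d}f=d\circ f-(-1)^{\deg(f)}f\circ d$. It is a superderivation, so $H^*(Y)=H^*(Y,\mathbf{d})$ is a graded associative algebra under the product induced by composition of cocycles. Homotopically equivalent means: there are morphisms of complexes of $A$-modules $F:X\to X'$ and $F':X'\to X$ and $A$-linear maps $s\in Y^{-1}$, $s'\in Y'^{-1}$ (i.e. raising the degree in $X$, resp. $X'$, by $1$) such that $F'F-\mathrm{id}_X=d_Xs+sd_X$ and $FF'-\mathrm{id}_{X'}=d_{X'}s'+s'd_{X'}$. *)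

theory Defs
  imports "HOL-Algebra.Module" "HOL-Algebra.QuotRing" "HOL-Algebra.Subrings"
begin

text \<open>
  The locale \<^locale>\<open>module\<close> of the library requires a commutative base ring, so left modules over an
  arbitrary ring are introduced here, with the same axioms and on the same record type.  The fields
  \<open>mult\<close> and \<open>one\<close> of that record are not used.
\<close>

locale left_module = R?: ring R + M?: abelian_group M
  for R :: "('a, 'm) ring_scheme" (structure) and M :: "('a, 'b, 'k) module_scheme" (structure) +
  assumes smult_closed:
      "\<lbrakk>a \<in> carrier R; x \<in> carrier M\<rbrakk> \<Longrightarrow> a \<odot>\<^bsub>M\<^esub> x \<in> carrier M"
    and smult_l_distr:
      "\<lbrakk>a \<in> carrier R; b \<in> carrier R; x \<in> carrier M\<rbrakk> \<Longrightarrow>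
        (a \<oplus> b) \<odot>\<^bsub>M\<^esub> x = a \<odot>\<^bsub>M\<^esub> x \<oplus>\<^bsub>M\<^esub> b \<odot>\<^bsub>M\<^esub> x"
    and smult_r_distr:
      "\<lbrakk>a \<in> carrier R; x \<in> carrier M; y \<in> carrier M\<rbrakk> \<Longrightarrow>
        a \<odot>\<^bsub>M\<^esub> (x \<oplus>\<^bsub>M\<^esub> y) = a \<odot>\<^bsub>M\<^esub> x \<oplus>\<^bsub>M\<^esub> a \<odot>\<^bsub>M\<^esub> y"
    and smult_assoc1:
      "\<lbrakk>a \<in> carrier R; b \<in> carrier R; x \<in> carrier M\<rbrakk> \<Longrightarrow>
        (a \<otimes> b) \<odot>\<^bsub>M\<^esub> x = a \<odot>\<^bsub>M\<^esub> (b \<odot>\<^bsub>M\<^esub> x)"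
    and smult_one:
      "x \<in> carrier M \<Longrightarrow> \<one> \<odot>\<^bsub>M\<^esub> x = x"

text \<open>Linear maps are extensional, so that HOL equality is equality of maps on the carrier.\<close>

definition linear_maps ::
    "('a, 'm) ring_scheme \<Rightarrow> ('a, 'b, 'k) module_scheme \<Rightarrow> ('a, 'c, 'l) module_scheme \<Rightarrow> ('b \<Rightarrow> 'c) set"
  where "linear_maps R M N = {f \<in> carrier M \<rightarrow>\<^sub>E carrier N.
    (\<forall>x\<in>carrier M. \<forall>y\<in>carrier M. f (x \<oplus>\<^bsub>M\<^esub> y) = f x \<oplus>\<^bsub>N\<^esub> f y) \<and>
    (\<forall>a\<in>carrier R. \<forall>x\<in>carrier M. f (a \<odot>\<^bsub>M\<^esub> x) = a \<odot>\<^bsub>N\<^esub> f x)}"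

text \<open>
  Families of linear maps \<open>X\<^sup>p \<rightarrow> X'\<^sup>p\<^sup>-\<^sup>n\<close>, one for each integer \<open>p\<close>.  Since the differentials of
  complexes lower the index by one, the differential of a complex has degree \<open>1\<close> in this sense, and
  a map raising the index by one has degree \<open>-1\<close>.
\<close>

definition graded_hom ::
    "('a, 'm) ring_scheme \<Rightarrow> (int \<Rightarrow> ('a, 'b, 'k) module_scheme) \<Rightarrow> (int \<Rightarrow> ('a, 'c, 'l) module_scheme)
      \<Rightarrow> int \<Rightarrow> (int \<Rightarrow> 'b \<Rightarrow> 'c) set"
  where "graded_hom R X X' n = {f. \<forall>p. f p \<in> linear_maps R (X p) (X' (p - n))}"

locale chain_complex =
  fixes R :: "('a, 'm) ring_scheme"
    and X :: "int \<Rightarrow> ('a, 'b, 'k) module_scheme"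
    and d :: "int \<Rightarrow> 'b \<Rightarrow> 'b"
  assumes modules: "left_module R (X p)"
    and differential: "d \<in> graded_hom R X X 1"
    and differential_squared: "x \<in> carrier (X p) \<Longrightarrow> d (p - 1) (d p x) = \<zero>\<^bsub>X (p - 2)\<^esub>"

definition chain_maps ::
    "('a, 'm) ring_scheme \<Rightarrow> (int \<Rightarrow> ('a, 'b, 'k) module_scheme) \<Rightarrow> (int \<Rightarrow> 'b \<Rightarrow> 'b)
      \<Rightarrow> (int \<Rightarrow> ('a, 'c, 'l) module_scheme) \<Rightarrow> (int \<Rightarrow> 'c \<Rightarrow> 'c) \<Rightarrow> (int \<Rightarrow> 'b \<Rightarrow> 'c) set"
  where "chain_maps R X d X' d' = {F \<in> graded_hom R X X' 0.
    \<forall>p. \<forall>x\<in>carrier (X p). F (p - 1) (d p x) = d' p (F p x)}"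

definition homotopy_equivalent ::
    "('a, 'm) ring_scheme \<Rightarrow> (int \<Rightarrow> ('a, 'b, 'k) module_scheme) \<Rightarrow> (int \<Rightarrow> 'b \<Rightarrow> 'b)
      \<Rightarrow> (int \<Rightarrow> ('a, 'c, 'l) module_scheme) \<Rightarrow> (int \<Rightarrow> 'c \<Rightarrow> 'c) \<Rightarrow> bool"
  where "homotopy_equivalent R X d X' d' \<longleftrightarrow>
    (\<exists>F \<in> chain_maps R X d X' d'. \<exists>F' \<in> chain_maps R X' d' X d.
     \<exists>s \<in> graded_hom R X X (-1). \<exists>s' \<in> graded_hom R X' X' (-1).
      (\<forall>p. \<forall>x\<in>carrier (X p).
        F' p (F p x) \<ominus>\<^bsub>X p\<^esub> x = d (p + 1) (s p x) \<oplus>\<^bsub>X p\<^esub> s (p - 1) (d p x)) \<and>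
      (\<forall>p. \<forall>x\<in>carrier (X' p).
        F p (F' p x) \<ominus>\<^bsub>X' p\<^esub> x = d' (p + 1) (s' p x) \<oplus>\<^bsub>X' p\<^esub> s' (p - 1) (d' p x)))"

text \<open>
  The graded algebra \<open>Y = \<Oplus>\<^sub>n Y\<^sup>n\<close> with \<open>Y\<^sup>n = graded_hom R X X n\<close>.  An element \<open>y\<close> is the finitely
  supported family of its homogeneous components, \<open>y n\<close> being the component of degree \<open>n\<close>, and
  \<open>y n p\<close> the corresponding map \<open>X\<^sup>p \<rightarrow> X\<^sup>p\<^sup>-\<^sup>n\<close>.  The product is the biadditive extension of
  composition: its component of degree \<open>n\<close> is the sum over \<open>k\<close> of the compositions
  \<open>X\<^sup>p \<rightarrow> X\<^sup>p\<^sup>-\<^sup>(\<^sup>n\<^sup>-\<^sup>k\<^sup>) \<rightarrow> X\<^sup>p\<^sup>-\<^sup>n\<close> of the degree \<open>n - k\<close> component of the right factor with the degree \<open>k\<close>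
  component of the left one.  No scalars are recorded beyond the ring structure, as \<open>Y\<close> is an
  associative algebra over the integers only.
\<close>

definition graded_zero :: "(int \<Rightarrow> ('a, 'b, 'k) module_scheme) \<Rightarrow> int \<Rightarrow> int \<Rightarrow> 'b \<Rightarrow> 'b"
  where "graded_zero X n = (\<lambda>p. \<lambda>x\<in>carrier (X p). \<zero>\<^bsub>X (p - n)\<^esub>)"

definition End_alg ::
    "('a, 'm) ring_scheme \<Rightarrow> (int \<Rightarrow> ('a, 'b, 'k) module_scheme) \<Rightarrow> (int \<Rightarrow> int \<Rightarrow> 'b \<Rightarrow> 'b) ring"
  where "End_alg R X =
    \<lparr>carrier = {y. (\<forall>n. y n \<in> graded_hom R X X n) \<and> finite {n. y n \<noteq> graded_zero X n}},
     mult = (\<lambda>y z n p. \<lambda>x\<in>carrier (X p).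
       \<Oplus>\<^bsub>X (p - n)\<^esub>k\<in>{k. y k \<noteq> graded_zero X k}. y k (p - (n - k)) (z (n - k) p x)),
     one = (\<lambda>n. if n = 0 then (\<lambda>p. \<lambda>x\<in>carrier (X p). x) else graded_zero X n),
     zero = graded_zero X,
     add = (\<lambda>y z n p. \<lambda>x\<in>carrier (X p). y n p x \<oplus>\<^bsub>X (p - n)\<^esub> z n p x)\<rparr>"

text \<open>
  \<open>graded_diff X d n f\<close> is \<open>d \<circ> f - (-1)\<^sup>n f \<circ> d\<close> for \<open>f\<close> of degree \<open>n\<close>, an element of degree \<open>n + 1\<close>;
  \<open>End_diff\<close> is its additive extension, so the component of degree \<open>n\<close> of the differential of \<open>y\<close>
  comes from the component of degree \<open>n - 1\<close> of \<open>y\<close>.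
\<close>

definition graded_diff ::
    "(int \<Rightarrow> ('a, 'b, 'k) module_scheme) \<Rightarrow> (int \<Rightarrow> 'b \<Rightarrow> 'b) \<Rightarrow> int \<Rightarrow> (int \<Rightarrow> 'b \<Rightarrow> 'b) \<Rightarrow> int \<Rightarrow> 'b \<Rightarrow> 'b"
  where "graded_diff X d n f = (\<lambda>p. \<lambda>x\<in>carrier (X p).
    if even n then d (p - n) (f p x) \<ominus>\<^bsub>X (p - (n + 1))\<^esub> f (p - 1) (d p x)
    else d (p - n) (f p x) \<oplus>\<^bsub>X (p - (n + 1))\<^esub> f (p - 1) (d p x))"

definition End_diff ::
    "(int \<Rightarrow> ('a, 'b, 'k) module_scheme) \<Rightarrow> (int \<Rightarrow> 'b \<Rightarrow> 'b) \<Rightarrow> (int \<Rightarrow> int \<Rightarrow> 'b \<Rightarrow> 'b) \<Rightarrow> int \<Rightarrow> int \<Rightarrow> 'b \<Rightarrow> 'b"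
  where "End_diff X d y = (\<lambda>n. graded_diff X d (n - 1) (y (n - 1)))"

definition End_cocycles ::
    "('a, 'm) ring_scheme \<Rightarrow> (int \<Rightarrow> ('a, 'b, 'k) module_scheme) \<Rightarrow> (int \<Rightarrow> 'b \<Rightarrow> 'b)
      \<Rightarrow> (int \<Rightarrow> int \<Rightarrow> 'b \<Rightarrow> 'b) set"
  where "End_cocycles R X d = {y \<in> carrier (End_alg R X). End_diff X d y = \<zero>\<^bsub>End_alg R X\<^esub>}"

definition End_coboundaries ::
    "('a, 'm) ring_scheme \<Rightarrow> (int \<Rightarrow> ('a, 'b, 'k) module_scheme) \<Rightarrow> (int \<Rightarrow> 'b \<Rightarrow> 'b)
      \<Rightarrow> (int \<Rightarrow> int \<Rightarrow> 'b \<Rightarrow> 'b) set"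
  where "End_coboundaries R X d = End_diff X d ` carrier (End_alg R X)"

text \<open>The cocycles form a subring of \<open>Y\<close> in which the coboundaries are a two-sided ideal.\<close>

definition End_cohomology ::
    "('a, 'm) ring_scheme \<Rightarrow> (int \<Rightarrow> ('a, 'b, 'k) module_scheme) \<Rightarrow> (int \<Rightarrow> 'b \<Rightarrow> 'b)
      \<Rightarrow> (int \<Rightarrow> int \<Rightarrow> 'b \<Rightarrow> 'b) set ring"
  where "End_cohomology R X d =
    (End_alg R X)\<lparr>carrier := End_cocycles R X d\<rparr> Quot End_coboundaries R X d"

text \<open>The homogeneous component of degree \<open>n\<close>: the classes of cocycles of degree \<open>n\<close>.\<close>

definition End_cohomology_deg ::
    "('a, 'm) ring_scheme \<Rightarrow> (int \<Rightarrow> ('a, 'b, 'k) module_scheme) \<Rightarrow> (int \<Rightarrow> 'b \<Rightarrow> 'b) \<Rightarrow> int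
      \<Rightarrow> (int \<Rightarrow> int \<Rightarrow> 'b \<Rightarrow> 'b) set set"
  where "End_cohomology_deg R X d n =
    {End_coboundaries R X d +>\<^bsub>End_alg R X\<^esub> z | z.
      z \<in> End_cocycles R X d \<and> (\<forall>k. k \<noteq> n \<longrightarrow> z k = graded_zero X k)}"

definition graded_ring_isomorphic ::
    "('a, 'k) ring_scheme \<Rightarrow> (int \<Rightarrow> 'a set) \<Rightarrow> ('b, 'l) ring_scheme \<Rightarrow> (int \<Rightarrow> 'b set) \<Rightarrow> bool"
  where "graded_ring_isomorphic H Hdeg H' Hdeg' \<longleftrightarrow>
    (\<exists>\<phi> \<in> ring_iso H H'. \<forall>n. \<phi> ` Hdeg n = Hdeg' n)"

end

theory Submission
  imports Defs
begin

text \<open>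
  Let \<open>F : X \<rightarrow> X'\<close> and \<open>F' : X' \<rightarrow> X\<close> be mutually inverse up to homotopies \<open>s\<close> and \<open>s'\<close>.  The
  isomorphism sends the class of a cocycle \<open>y\<close> to the class of \<open>\<Phi> y = F y F'\<close>.  The map \<open>\<Phi>\<close> is
  additive, preserves degrees and, since \<open>F\<close> and \<open>F'\<close> commute with the differentials, commutes with
  the differentials \<open>D\<close> of \<open>End X\<close> and \<open>D'\<close> of \<open>End X'\<close>.  It is in general not multiplicative, but
  \<open>\<Phi> y \<Phi> z = F y (F' F) z F'\<close>, and \<open>F' F = 1 + D s\<close>.  If \<open>y\<close> and \<open>z\<close> are cocycles and \<open>y\<close> is
  homogeneous, then \<open>y (D s) z = \<plusminus> D (y s z)\<close> by the Leibniz rule.  So, for all cocycles \<open>y\<close> and \<open>z\<close>,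
  \<open>\<Phi> y \<Phi> z\<close> and \<open>\<Phi> (y z)\<close> are cohomologous.  Likewise \<open>\<Phi> 1 = F F' = 1 + D' s'\<close>.  With
  \<open>\<Psi> y = F' y F\<close> and \<open>y\<close> a cocycle, \<open>\<Psi> (\<Phi> y) = (1 + D s) y (1 + D s)\<close> is cohomologous to \<open>y\<close>, and
  symmetrically for \<open>\<Phi> \<Psi>\<close>.  So \<open>\<Phi>\<close> induces a bijective ring homomorphism of the cohomology rings.

  The argument uses only a ring with a differential that satisfies a signed Leibniz rule, and
  it is carried out at this level, in \<open>cohomology_iso\<close>.  Two facts connect it with complexes.  One is
  \<open>End_ring\<close>: \<open>End X\<close> is an associative ring, by manipulations of finite sums over degrees.  The
  other is that its differential is the supercommutator with the odd element \<open>d\<close> of square zero,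
  so that the axioms of a differential superring follow from ring identities
  (\<open>supercommutator_differential_superring\<close>).  The identities for \<open>\<Phi>\<close> are
  checked on components; the formula for \<open>\<Phi> y \<Phi> z\<close> is \<open>conjugate_mult\<close>.
\<close>

section \<open>Differential superrings and their cohomology\<close>

text \<open>
  Only the parity of degrees enters the sign in the Leibniz rule, so the grading is replaced by an
  involution \<open>\<sigma>\<close>, which acts by \<open>(-1)\<^sup>n\<close> on elements of degree \<open>n\<close>.
  The differential is odd, whence it anticommutes with \<open>\<sigma>\<close>.
\<close>

locale differential_superring = ring R for R :: "('a, 'm) ring_scheme" (structure) +
  fixes \<sigma> :: "'a \<Rightarrow> 'a" and D :: "'a \<Rightarrow> 'a"
  assumes parity_hom: "\<sigma> \<in> ring_hom R R"
    and diff_closed [simp, intro]: "x \<in> carrier R \<Longrightarrow> D x \<in> carrier R"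
    and parity_parity [simp]: "x \<in> carrier R \<Longrightarrow> \<sigma> (\<sigma> x) = x"
    and diff_add: "\<lbrakk>x \<in> carrier R; y \<in> carrier R\<rbrakk> \<Longrightarrow> D (x \<oplus> y) = D x \<oplus> D y"
    and diff_diff [simp]: "x \<in> carrier R \<Longrightarrow> D (D x) = \<zero>"
    and diff_parity: "x \<in> carrier R \<Longrightarrow> D (\<sigma> x) = \<ominus> \<sigma> (D x)"
    and diff_mult: "\<lbrakk>x \<in> carrier R; y \<in> carrier R\<rbrakk> \<Longrightarrow> D (x \<otimes> y) = D x \<otimes> y \<oplus> \<sigma> x \<otimes> D y"
begin

definition cocycles :: "'a set"
  where "cocycles = {x \<in> carrier R. D x = \<zero>}"

definition coboundaries :: "'a set"
  where "coboundaries = D ` carrier R"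

definition cocycle_ring :: "('a, 'm) ring_scheme"
  where "cocycle_ring = R\<lparr>carrier := cocycles\<rparr>"

definition cohomology :: "'a set ring"
  where "cohomology = cocycle_ring Quot coboundaries"

definition cohomology_class :: "'a \<Rightarrow> 'a set"
  where "cohomology_class x = coboundaries +> x"

lemma parity_closed [simp, intro]: "x \<in> carrier R \<Longrightarrow> \<sigma> x \<in> carrier R"
  using parity_hom by (rule ring_hom_closed)

lemma parity_zero [simp]: "\<sigma> \<zero> = \<zero>"
  using parity_hom by (rule ring_hom_zero) (rule ring_axioms)+

lemma diff_zero [simp]: "D \<zero> = \<zero>"
proof -
  have "D \<zero> \<oplus> D \<zero> = D \<zero> \<oplus> \<zero>" using diff_add[of \<zero> \<zero>] by simp
  then show ?thesis by (simp del: r_zero)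
qed

lemma diff_a_inv: "x \<in> carrier R \<Longrightarrow> D (\<ominus> x) = \<ominus> D x"
  using diff_add[of "\<ominus> x" x] by (simp add: l_neg minus_equality)

lemma diff_one [simp]: "D \<one> = \<zero>"
proof -
  have "\<sigma> \<one> = \<one>" using parity_hom by (rule ring_hom_one)
  then have "D \<one> \<oplus> D \<one> = D \<one> \<oplus> \<zero>" using diff_mult[of \<one> \<one>] by simp
  then show ?thesis by (simp del: r_zero)
qed

lemma cocycle_closed: "x \<in> cocycles \<Longrightarrow> x \<in> carrier R"
  by (simp add: cocycles_def)

lemma coboundary_in_cocycles: "x \<in> carrier R \<Longrightarrow> D x \<in> cocycles"
  by (simp add: cocycles_def)

lemma parity_cocycle: "x \<in> cocycles \<Longrightarrow> \<sigma> x \<in> cocycles"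
  by (simp add: cocycles_def diff_parity)

lemma cocycle_mult: "\<lbrakk>x \<in> cocycles; y \<in> cocycles\<rbrakk> \<Longrightarrow> x \<otimes> y \<in> cocycles"
  by (simp add: cocycles_def diff_mult)

text \<open>
  Applying \<open>\<sigma>\<close> to the cocycle compensates the sign in the Leibniz rule; this makes the
  coboundaries a left ideal in the cocycles, and not only a right one.
\<close>

lemma diff_mult_left_cocycle:
  assumes "z \<in> cocycles" "x \<in> carrier R"
  shows "D (\<sigma> z \<otimes> x) = z \<otimes> D x"
  using assms parity_cocycle[of z] by (simp add: cocycles_def diff_mult)

lemma diff_mult_right_cocycle:
  assumes "z \<in> cocycles" "x \<in> carrier R"
  shows "D (x \<otimes> z) = D x \<otimes> z"
  using assms by (simp add: cocycles_def diff_mult)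

lemma cocycles_subring: "subring cocycles R"
  by (rule subringI) (auto simp: cocycles_def diff_a_inv diff_add diff_mult)

lemma ring_cocycle_ring: "ring cocycle_ring"
  unfolding cocycle_ring_def using cocycles_subring by (rule subring_is_ring)

lemma cocycle_ring_simps [simp]:
  "carrier cocycle_ring = cocycles" "mult cocycle_ring = mult R" "one cocycle_ring = \<one>"
  "add cocycle_ring = add R" "zero cocycle_ring = \<zero>"
  by (simp_all add: cocycle_ring_def)

lemma a_r_coset_cocycle_ring: "a_r_coset cocycle_ring = a_r_coset R"
  by (intro ext) (simp add: a_r_coset_def')

lemma coboundaries_ideal: "ideal coboundaries cocycle_ring"
proof (rule idealI)
  interpret C: ring cocycle_ring by (rule ring_cocycle_ring)
  show "ring cocycle_ring" by (rule ring_cocycle_ring)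
  show "subgroup coboundaries (add_monoid cocycle_ring)"
  proof (rule C.add.subgroupI)
    show "coboundaries \<subseteq> carrier cocycle_ring"
      by (auto simp: coboundaries_def coboundary_in_cocycles)
    show "coboundaries \<noteq> {}" by (auto simp: coboundaries_def)
    fix a b assume "a \<in> coboundaries" "b \<in> coboundaries"
    then obtain u v where uv: "u \<in> carrier R" "v \<in> carrier R" "a = D u" "b = D v"
      by (auto simp: coboundaries_def)
    then have "a \<oplus>\<^bsub>cocycle_ring\<^esub> b = D (u \<oplus> v)" by (simp add: diff_add)
    then show "a \<oplus>\<^bsub>cocycle_ring\<^esub> b \<in> coboundaries"
      using uv by (auto simp: coboundaries_def)
    have "D (\<ominus> u) \<oplus> D u = \<zero>" using uv by (simp add: diff_a_inv l_neg)
    then have "\<ominus>\<^bsub>cocycle_ring\<^esub> a = D (\<ominus> u)"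
      using uv by (intro C.minus_equality) (simp_all add: coboundary_in_cocycles)
    then show "\<ominus>\<^bsub>cocycle_ring\<^esub> a \<in> coboundaries"
      using uv by (auto simp: coboundaries_def)
  qed
next
  fix a x assume "a \<in> coboundaries" and x: "x \<in> carrier cocycle_ring"
  then obtain u where u: "u \<in> carrier R" "a = D u" by (auto simp: coboundaries_def)
  have [simp]: "x \<in> carrier R" using x by (simp add: cocycle_closed)
  have "x \<otimes> a = D (\<sigma> x \<otimes> u)" using u x by (simp add: diff_mult_left_cocycle)
  then show "x \<otimes>\<^bsub>cocycle_ring\<^esub> a \<in> coboundaries"
    using u by (auto simp: coboundaries_def)
  have "a \<otimes> x = D (u \<otimes> x)" using u x by (simp add: diff_mult_right_cocycle)
  then show "a \<otimes>\<^bsub>cocycle_ring\<^esub> x \<in> coboundaries"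
    using u by (auto simp: coboundaries_def)
qed

lemma ring_cohomology: "ring cohomology"
  unfolding cohomology_def using coboundaries_ideal by (rule ideal.quotient_is_ring)

lemma cohomology_class_hom: "cohomology_class \<in> ring_hom cocycle_ring cohomology"
proof -
  have "cohomology_class = a_r_coset cocycle_ring coboundaries"
    by (intro ext) (simp add: cohomology_class_def a_r_coset_cocycle_ring)
  then show ?thesis
    using ideal.rcos_ring_hom[OF coboundaries_ideal] by (simp add: cohomology_def)
qed

lemma carrier_cohomology: "carrier cohomology = cohomology_class ` cocycles"
  by (auto simp: cohomology_def FactRing_def A_RCOSETS_def' a_r_coset_cocycle_ring
      cohomology_class_def)

lemma cohomology_class_eq_iff:
  assumes x: "x \<in> carrier R" and y: "y \<in> carrier R"
  shows "cohomology_class x = cohomology_class y \<longleftrightarrow> (\<exists>u\<in>carrier R. x = y \<oplus> D u)"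
proof
  assume eq: "cohomology_class x = cohomology_class y"
  have "D \<zero> \<oplus> x \<in> cohomology_class x"
    by (auto simp: cohomology_class_def a_r_coset_def' coboundaries_def simp del: diff_zero)
  then have "x \<in> cohomology_class y" using eq x by simp
  then show "\<exists>u\<in>carrier R. x = y \<oplus> D u"
    using y by (auto simp: cohomology_class_def a_r_coset_def' coboundaries_def a_comm)
next
  have sub: "cohomology_class a \<subseteq> cohomology_class b"
    if ab: "a = b \<oplus> D u" "a \<in> carrier R" "b \<in> carrier R" "u \<in> carrier R" for a b u
  proof
    fix c assume "c \<in> cohomology_class a"
    then obtain v where v: "v \<in> carrier R" "c = D v \<oplus> a"
      by (auto simp: cohomology_class_def a_r_coset_def' coboundaries_def)
    then have "c = D (v \<oplus> u) \<oplus> b" using ab by (simp add: diff_add a_ac)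
    then show "c \<in> cohomology_class b"
      using v ab by (auto simp: cohomology_class_def a_r_coset_def' coboundaries_def)
  qed
  assume "\<exists>u\<in>carrier R. x = y \<oplus> D u"
  then obtain u where u: "u \<in> carrier R" "x = y \<oplus> D u" by auto
  then have "y = x \<oplus> D (\<ominus> u)" using y by (simp add: diff_a_inv a_assoc r_neg)
  then show "cohomology_class x = cohomology_class y"
    using sub[OF u(2) x y u(1)] sub[of y x "\<ominus> u"] u x y by auto
qed

text \<open>
  The factor \<open>\<one> \<oplus> D s\<close> is a cocycle cohomologous to \<open>\<one>\<close>.  The correction term is
  written out because it has to be carried through additive maps that need not be multiplicative.
\<close>

lemma mult_one_plus_diff:
  assumes x: "x \<in> cocycles" and y: "y \<in> cocycles" and s: "s \<in> carrier R"
  shows "x \<otimes> (\<one> \<oplus> D s) \<otimes> y = x \<otimes> y \<oplus> D (\<sigma> x \<otimes> s \<otimes> y)"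
proof -
  have [simp]: "x \<in> carrier R" "y \<in> carrier R" using x y by (simp_all add: cocycle_closed)
  have "D (\<sigma> x \<otimes> s \<otimes> y) = x \<otimes> D s \<otimes> y"
    using x y s by (simp add: diff_mult_right_cocycle diff_mult_left_cocycle)
  then show ?thesis using s by (simp add: l_distr r_distr)
qed

lemma one_plus_diff_cocycle: "s \<in> carrier R \<Longrightarrow> \<one> \<oplus> D s \<in> cocycles"
  by (simp add: cocycles_def diff_add)

text \<open>
  Both factors \<open>\<one> \<oplus> D s\<close> are removed by the preceding computation, with \<open>\<one>\<close> as one of the outer
  cocycles.
\<close>

lemma sandwich_class:
  assumes x: "x \<in> cocycles" and s: "s \<in> carrier R"
  shows "cohomology_class ((\<one> \<oplus> D s) \<otimes> x \<otimes> (\<one> \<oplus> D s)) = cohomology_class x"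
proof -
  let ?e = "\<one> \<oplus> D s"
  have one: "\<one> \<in> cocycles" by (simp add: cocycles_def)
  have x': "x \<in> carrier R" using x by (rule cocycle_closed)
  have e: "?e \<in> carrier R" using s by simp
  have ex: "?e \<otimes> x \<in> cocycles" using x s by (intro cocycle_mult one_plus_diff_cocycle)
  then have ex': "?e \<otimes> x \<in> carrier R" by (rule cocycle_closed)
  have "?e \<otimes> x \<otimes> ?e = ?e \<otimes> x \<oplus> D (\<sigma> (?e \<otimes> x) \<otimes> s)"
    using mult_one_plus_diff[OF ex one s] ex' s e x' by simp
  then have "cohomology_class (?e \<otimes> x \<otimes> ?e) = cohomology_class (?e \<otimes> x)"
    using ex' s e by (subst cohomology_class_eq_iff) (blast intro: m_closed parity_closed)+
  moreover have "?e \<otimes> x = x \<oplus> D (\<sigma> \<one> \<otimes> s \<otimes> x)"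
    using mult_one_plus_diff[OF one x s] s e x' by simp
  then have "cohomology_class (?e \<otimes> x) = cohomology_class x"
    using ex' s x' by (subst cohomology_class_eq_iff) (blast intro: m_closed parity_closed one_closed)+
  ultimately show ?thesis by simp
qed

end

section \<open>Homotopy equivalences of differential superrings\<close>

text \<open>
  The model is \<open>\<Phi> x = F x F'\<close> for chain maps \<open>F : X \<rightarrow> X'\<close> and \<open>F' : X' \<rightarrow> X\<close>.  Then
  \<open>\<Phi> x \<Phi> y = F x (F' F) y F'\<close>, where \<open>F' F = 1 + D s\<close>, and \<open>\<Phi> 1 = F F' = 1 + E t\<close>.  So
  \<open>\<Phi>\<close> fails to be a ring homomorphism exactly by the homotopies.
\<close>

locale differential_superring_homotopy =
  R: differential_superring R \<sigma> D + S: differential_superring S \<tau> E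
  for R :: "('a, 'm) ring_scheme" and \<sigma> D
    and S :: "('b, 'n) ring_scheme" and \<tau> E +
  fixes \<Phi> :: "'a \<Rightarrow> 'b" and s :: 'a and t :: 'b
  assumes homotopies: "s \<in> carrier R" "t \<in> carrier S"
    and map_closed [simp]: "x \<in> carrier R \<Longrightarrow> \<Phi> x \<in> carrier S"
    and map_add: "\<lbrakk>x \<in> carrier R; y \<in> carrier R\<rbrakk> \<Longrightarrow> \<Phi> (x \<oplus>\<^bsub>R\<^esub> y) = \<Phi> x \<oplus>\<^bsub>S\<^esub> \<Phi> y"
    and map_diff: "x \<in> carrier R \<Longrightarrow> \<Phi> (D x) = E (\<Phi> x)"
    and map_mult: "\<lbrakk>x \<in> carrier R; y \<in> carrier R\<rbrakk> \<Longrightarrow>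
      \<Phi> x \<otimes>\<^bsub>S\<^esub> \<Phi> y = \<Phi> (x \<otimes>\<^bsub>R\<^esub> (\<one>\<^bsub>R\<^esub> \<oplus>\<^bsub>R\<^esub> D s) \<otimes>\<^bsub>R\<^esub> y)"
    and map_one: "\<Phi> \<one>\<^bsub>R\<^esub> = \<one>\<^bsub>S\<^esub> \<oplus>\<^bsub>S\<^esub> E t"
begin

lemma map_cocycle: "x \<in> R.cocycles \<Longrightarrow> \<Phi> x \<in> S.cocycles"
proof -
  assume x: "x \<in> R.cocycles"
  have "\<Phi> \<zero>\<^bsub>R\<^esub> \<oplus>\<^bsub>S\<^esub> \<Phi> \<zero>\<^bsub>R\<^esub> = \<Phi> \<zero>\<^bsub>R\<^esub> \<oplus>\<^bsub>S\<^esub> \<zero>\<^bsub>S\<^esub>" using map_add[of "\<zero>\<^bsub>R\<^esub>" "\<zero>\<^bsub>R\<^esub>"] by simp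
  then have "\<Phi> \<zero>\<^bsub>R\<^esub> = \<zero>\<^bsub>S\<^esub>" by (simp del: S.r_zero)
  then show ?thesis using x map_diff[of x] by (simp add: R.cocycles_def S.cocycles_def)
qed

lemma map_class_hom:
  "(\<lambda>x. S.cohomology_class (\<Phi> x)) \<in> ring_hom R.cocycle_ring S.cohomology"
proof (rule ring_hom_memI)
  note S_hom = S.cohomology_class_hom
  fix x y assume "x \<in> carrier R.cocycle_ring" "y \<in> carrier R.cocycle_ring"
  then have xy: "x \<in> R.cocycles" "y \<in> R.cocycles" by simp_all
  then have xy': "x \<in> carrier R" "y \<in> carrier R" by (simp_all add: R.cocycle_closed)
  show "S.cohomology_class (\<Phi> x) \<in> carrier S.cohomology"
    using xy by (simp add: S.carrier_cohomology map_cocycle)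
  show "S.cohomology_class (\<Phi> (x \<oplus>\<^bsub>R.cocycle_ring\<^esub> y))
      = S.cohomology_class (\<Phi> x) \<oplus>\<^bsub>S.cohomology\<^esub> S.cohomology_class (\<Phi> y)"
    using xy xy' ring_hom_add[OF S_hom, of "\<Phi> x" "\<Phi> y"] by (simp add: map_add map_cocycle)
  \<comment> \<open>The defect of multiplicativity on cocycles is the image of a coboundary, hence a coboundary.\<close>
  let ?u = "\<sigma> x \<otimes>\<^bsub>R\<^esub> s \<otimes>\<^bsub>R\<^esub> y"
  have u: "?u \<in> carrier R" using xy' homotopies by simp
  have "\<Phi> x \<otimes>\<^bsub>S\<^esub> \<Phi> y = \<Phi> (x \<otimes>\<^bsub>R\<^esub> y) \<oplus>\<^bsub>S\<^esub> E (\<Phi> ?u)"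
    using xy xy' u homotopies by (simp add: map_mult R.mult_one_plus_diff map_add map_diff)
  then have "S.cohomology_class (\<Phi> x \<otimes>\<^bsub>S\<^esub> \<Phi> y) = S.cohomology_class (\<Phi> (x \<otimes>\<^bsub>R\<^esub> y))"
    using xy' u by (subst S.cohomology_class_eq_iff) auto
  then show "S.cohomology_class (\<Phi> (x \<otimes>\<^bsub>R.cocycle_ring\<^esub> y))
      = S.cohomology_class (\<Phi> x) \<otimes>\<^bsub>S.cohomology\<^esub> S.cohomology_class (\<Phi> y)"
    using xy ring_hom_mult[OF S_hom, of "\<Phi> x" "\<Phi> y"] by (simp add: map_cocycle)
next
  have "S.cohomology_class (\<Phi> \<one>\<^bsub>R\<^esub>) = S.cohomology_class \<one>\<^bsub>S\<^esub>"
    using map_one homotopies by (subst S.cohomology_class_eq_iff) auto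
  then show "S.cohomology_class (\<Phi> \<one>\<^bsub>R.cocycle_ring\<^esub>) = \<one>\<^bsub>S.cohomology\<^esub>"
    using ring_hom_one[OF S.cohomology_class_hom] by simp
qed

end

locale differential_superring_homotopy_equivalence =
  F: differential_superring_homotopy R \<sigma> D S \<tau> E \<Phi> s t +
  G: differential_superring_homotopy S \<tau> E R \<sigma> D \<Psi> t s
  for R :: "('a, 'm) ring_scheme" and \<sigma> D
    and S :: "('b, 'n) ring_scheme" and \<tau> E \<Phi> \<Psi> s t +
  assumes back_forth: "x \<in> carrier R \<Longrightarrow>
      \<Psi> (\<Phi> x) = (\<one>\<^bsub>R\<^esub> \<oplus>\<^bsub>R\<^esub> D s) \<otimes>\<^bsub>R\<^esub> x \<otimes>\<^bsub>R\<^esub> (\<one>\<^bsub>R\<^esub> \<oplus>\<^bsub>R\<^esub> D s)"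
    and forth_back: "y \<in> carrier S \<Longrightarrow>
      \<Phi> (\<Psi> y) = (\<one>\<^bsub>S\<^esub> \<oplus>\<^bsub>S\<^esub> E t) \<otimes>\<^bsub>S\<^esub> y \<otimes>\<^bsub>S\<^esub> (\<one>\<^bsub>S\<^esub> \<oplus>\<^bsub>S\<^esub> E t)"
begin

lemma forth_back_class:
  "y \<in> F.S.cocycles \<Longrightarrow> F.S.cohomology_class (\<Phi> (\<Psi> y)) = F.S.cohomology_class y"
  by (simp add: forth_back F.S.cocycle_closed F.homotopies F.S.sandwich_class)

text \<open>
  If \<open>\<Phi> x\<close> is a coboundary, so is \<open>\<Psi> (\<Phi> x)\<close>, which is cohomologous to \<open>x\<close>.
\<close>

lemma kernel_map_class:
  "a_kernel F.R.cocycle_ring F.S.cohomology (\<lambda>x. F.S.cohomology_class (\<Phi> x))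
    = F.R.coboundaries"
proof -
  have zero: "\<zero>\<^bsub>F.S.cohomology\<^esub> = F.S.cohomology_class \<zero>\<^bsub>S\<^esub>"
    using ring_hom_zero[OF F.S.cohomology_class_hom F.S.ring_cocycle_ring
        F.S.ring_cohomology] by simp
  have bd: "x \<in> F.R.coboundaries"
    if x: "x \<in> F.R.cocycles" and eq: "F.S.cohomology_class (\<Phi> x) = F.S.cohomology_class \<zero>\<^bsub>S\<^esub>"
    for x
  proof -
    have x': "x \<in> carrier R" using x by (rule F.R.cocycle_closed)
    obtain u where u: "u \<in> carrier S" "\<Phi> x = E u"
      using eq x' by (auto simp: F.S.cohomology_class_eq_iff)
    then have *: "\<Psi> (\<Phi> x) = D (\<Psi> u)" by (simp add: G.map_diff)
    have "F.R.cohomology_class x = F.R.cohomology_class (\<Psi> (\<Phi> x))"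
      using x x' by (simp add: back_forth F.homotopies F.R.sandwich_class)
    then obtain v where v: "v \<in> carrier R" "x = D (\<Psi> u) \<oplus>\<^bsub>R\<^esub> D v"
      using x' u unfolding * by (subst (asm) F.R.cohomology_class_eq_iff) auto
    then have "x = D (\<Psi> u \<oplus>\<^bsub>R\<^esub> v)" using u by (simp add: F.R.diff_add)
    then show ?thesis using u v by (auto simp: F.R.coboundaries_def)
  qed
  have "F.S.cohomology_class (\<Phi> (D u)) = F.S.cohomology_class \<zero>\<^bsub>S\<^esub>" if "u \<in> carrier R" for u
    using that by (subst F.S.cohomology_class_eq_iff) (auto simp: F.map_diff)
  then show ?thesis
    using bd by (auto simp: a_kernel_def' zero F.R.coboundaries_def F.R.coboundary_in_cocycles)
qed

lemma surj_map_class: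
  "(\<lambda>x. F.S.cohomology_class (\<Phi> x)) ` F.R.cocycles = carrier F.S.cohomology"
proof -
  have "F.S.cohomology_class y \<in> (\<lambda>x. F.S.cohomology_class (\<Phi> x)) ` F.R.cocycles"
    if "y \<in> F.S.cocycles" for y
    using that by (intro image_eqI[of _ _ "\<Psi> y"]) (simp_all add: forth_back_class G.map_cocycle)
  then show ?thesis by (auto simp: F.S.carrier_cohomology F.map_cocycle)
qed

text \<open>
  The isomorphism comes from the homomorphism theorem for rings, applied to the map from the cocycles
  of \<open>R\<close> to the cohomology of \<open>S\<close>.  Its values on classes are part of the conclusion because they show
  which further structure, such as a grading, it respects.
\<close>

theorem cohomology_iso:
  obtains \<phi> where "\<phi> \<in> ring_iso F.R.cohomology F.S.cohomology"
    and "\<And>x. x \<in> F.R.cocycles \<Longrightarrow>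
      \<phi> (F.R.cohomology_class x) = F.S.cohomology_class (\<Phi> x)"
proof -
  define h where "h = (\<lambda>x. F.S.cohomology_class (\<Phi> x))"
  interpret h: ring_hom_ring F.R.cocycle_ring F.S.cohomology h
    unfolding h_def
    by (rule ring_hom_ringI2[OF F.R.ring_cocycle_ring F.S.ring_cohomology F.map_class_hom])
  have ker: "a_kernel F.R.cocycle_ring F.S.cohomology h = F.R.coboundaries"
    unfolding h_def by (rule kernel_map_class)
  have "(\<lambda>C. the_elem (h ` C)) \<in> ring_iso F.R.cohomology F.S.cohomology"
    using h.FactRing_iso_set surj_map_class[folded h_def]
    unfolding ker F.R.cohomology_def F.R.cocycle_ring_simps .
  moreover have "the_elem (h ` F.R.cohomology_class x) = h x" if "x \<in> F.R.cocycles" for x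
    using h.the_elem_simp[of x] that
    by (simp add: ker F.R.cohomology_class_def F.R.a_r_coset_cocycle_ring)
  ultimately show thesis using that unfolding h_def by blast
qed

end

section \<open>Differentials given by supercommutators\<close>

text \<open>
  The differential of an endomorphism complex is the supercommutator with the differential of the
  complex.  Hence the Leibniz rule and \<open>D\<^sup>2 = 0\<close> are identities in a ring, and no computation
  with graded components is needed for them.
\<close>

lemma supercommutator_differential_superring:
  fixes R (structure)
  assumes "ring R" and \<sigma>: "\<sigma> \<in> ring_hom R R" and \<sigma>\<sigma>: "\<And>x. x \<in> carrier R \<Longrightarrow> \<sigma> (\<sigma> x) = x"
    and \<delta>: "\<delta> \<in> carrier R" "\<delta> \<otimes> \<delta> = \<zero>" "\<sigma> \<delta> = \<ominus> \<delta>"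
    and D: "\<And>x. x \<in> carrier R \<Longrightarrow> D x = \<delta> \<otimes> x \<ominus> \<sigma> x \<otimes> \<delta>"
  shows "differential_superring R \<sigma> D"
proof -
  interpret ring R by fact
  interpret \<sigma>: ring_hom_ring R R \<sigma> by (rule ring_hom_ringI2[OF ring_axioms ring_axioms \<sigma>])
  have dd: "\<delta> \<otimes> (\<delta> \<otimes> x) = \<zero>" "x \<otimes> \<delta> \<otimes> \<delta> = \<zero>" if "x \<in> carrier R" for x
    using that \<delta> by (simp_all add: m_assoc[symmetric], simp_all add: m_assoc)
  show ?thesis
  proof
    fix x y assume [simp]: "x \<in> carrier R" "y \<in> carrier R"
    note [simp] = \<delta> \<sigma>\<sigma>
    show "D x \<in> carrier R" by (simp add: D)
    show "D (x \<oplus> y) = D x \<oplus> D y"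
      by (simp add: D minus_eq r_distr l_distr minus_add a_ac)
    show "D (D x) = \<zero>"
      by (simp add: D minus_eq r_distr l_distr l_minus r_minus dd m_assoc l_neg)
    show "D (\<sigma> x) = \<ominus> \<sigma> (D x)"
      by (simp add: D minus_eq r_distr l_distr l_minus r_minus minus_add)
    show "D (x \<otimes> y) = D x \<otimes> y \<oplus> \<sigma> x \<otimes> D y"
      by (simp add: D minus_eq r_distr l_distr l_minus r_minus m_assoc a_assoc r_neg1 l_neg r_neg2)
  qed (use \<sigma> \<sigma>\<sigma> in auto)
qed

section \<open>Maps between graded modules\<close>

lemma (in abelian_monoid) finsum_swap:
  assumes "finite I" "finite J" "\<And>i j. \<lbrakk>i \<in> I; j \<in> J\<rbrakk> \<Longrightarrow> f i j \<in> carrier G"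
  shows "(\<Oplus>i\<in>I. \<Oplus>j\<in>J. f i j) = (\<Oplus>j\<in>J. \<Oplus>i\<in>I. f i j)"
  using assms(1,3)
proof (induction I)
  case (insert i I)
  have closed: "\<And>k. k \<in> insert i I \<Longrightarrow> (\<Oplus>j\<in>J. f k j) \<in> carrier G"
      "\<And>j. j \<in> J \<Longrightarrow> (\<Oplus>k\<in>I. f k j) \<in> carrier G"
    using insert.prems by (auto intro!: finsum_closed)
  have "(\<Oplus>k\<in>insert i I. \<Oplus>j\<in>J. f k j) = (\<Oplus>j\<in>J. f i j) \<oplus> (\<Oplus>k\<in>I. \<Oplus>j\<in>J. f k j)"
    using insert.hyps closed by (intro finsum_insert) auto
  also have "(\<Oplus>k\<in>I. \<Oplus>j\<in>J. f k j) = (\<Oplus>j\<in>J. \<Oplus>k\<in>I. f k j)"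
    using insert.prems by (intro insert.IH) auto
  also have "(\<Oplus>j\<in>J. f i j) \<oplus> \<dots> = (\<Oplus>j\<in>J. f i j \<oplus> (\<Oplus>k\<in>I. f k j))"
    using insert.prems closed by (intro finsum_addf[symmetric]) auto
  also have "\<dots> = (\<Oplus>j\<in>J. \<Oplus>k\<in>insert i I. f k j)"
    using insert.hyps insert.prems closed
    by (intro finsum_cong' refl) (auto intro!: finsum_insert[symmetric] finsum_closed)
  finally show ?case .
qed simp

lemma additive_finsum:
  assumes "abelian_group M" "abelian_group N"
    and closed: "\<And>x. x \<in> carrier M \<Longrightarrow> f x \<in> carrier N"
    and add: "\<And>x y. \<lbrakk>x \<in> carrier M; y \<in> carrier M\<rbrakk> \<Longrightarrow> f (x \<oplus>\<^bsub>M\<^esub> y) = f x \<oplus>\<^bsub>N\<^esub> f y"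
    and "finite I" and g: "\<And>i. i \<in> I \<Longrightarrow> g i \<in> carrier M"
  shows "f (\<Oplus>\<^bsub>M\<^esub>i\<in>I. g i) = (\<Oplus>\<^bsub>N\<^esub>i\<in>I. f (g i))"
proof -
  interpret M: abelian_group M by fact
  interpret N: abelian_group N by fact
  have "f \<zero>\<^bsub>M\<^esub> \<oplus>\<^bsub>N\<^esub> f \<zero>\<^bsub>M\<^esub> = f \<zero>\<^bsub>M\<^esub> \<oplus>\<^bsub>N\<^esub> \<zero>\<^bsub>N\<^esub>" using add[of "\<zero>\<^bsub>M\<^esub>" "\<zero>\<^bsub>M\<^esub>"] closed by simp
  then have "f \<zero>\<^bsub>M\<^esub> = \<zero>\<^bsub>N\<^esub>" using closed by (simp del: N.r_zero)
  with \<open>finite I\<close> g show ?thesis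
  proof (induction I)
    case (insert i I)
    then show ?case using closed by (simp add: Pi_def add)
  qed simp
qed

locale graded_module =
  fixes R :: "('a, 'm) ring_scheme"
    and X :: "int \<Rightarrow> ('a, 'b, 'k) module_scheme"
  assumes component_module: "left_module R (X p)"

lemma (in graded_module) component_abelian_group: "abelian_group (X p)"
  using component_module by (rule left_module.axioms(2))

sublocale graded_module \<subseteq> M: abelian_group "X p" for p
  by (rule component_abelian_group)

sublocale chain_complex \<subseteq> graded_module R X
  by (rule graded_module.intro) (rule modules)

locale graded_module_pair = graded_module R X + X': graded_module R X'
  for R :: "('a, 'm) ring_scheme"
    and X :: "int \<Rightarrow> ('a, 'b, 'k) module_scheme"
    and X' :: "int \<Rightarrow> ('a, 'c, 'l) module_scheme"
begin

text \<open>
  Indexing the source as \<open>q + n\<close>, where \<open>q\<close> is the index of the target, keeps the index expressions of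
  compositions in a form in which they match by cancellation; the criteria for equality and the
  formulas for products below have the same shape.
\<close>

lemma graded_homI:
  assumes ext: "\<And>p. f p \<in> extensional (carrier (X p))"
    and closed: "\<And>q x. x \<in> carrier (X (q + n)) \<Longrightarrow> f (q + n) x \<in> carrier (X' q)"
    and add: "\<And>q x y. \<lbrakk>x \<in> carrier (X (q + n)); y \<in> carrier (X (q + n))\<rbrakk>
      \<Longrightarrow> f (q + n) (x \<oplus>\<^bsub>X (q + n)\<^esub> y) = f (q + n) x \<oplus>\<^bsub>X' q\<^esub> f (q + n) y"
    and smult: "\<And>q a x. \<lbrakk>a \<in> carrier R; x \<in> carrier (X (q + n))\<rbrakk>
      \<Longrightarrow> f (q + n) (a \<odot>\<^bsub>X (q + n)\<^esub> x) = a \<odot>\<^bsub>X' q\<^esub> f (q + n) x"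
  shows "f \<in> graded_hom R X X' n"
  using ext closed[of _ "p - n" for p] add[of _ "p - n" for p] smult[of _ _ "p - n" for p]
  by (auto simp: graded_hom_def linear_maps_def PiE_def)

lemma graded_hom_closed:
  "\<lbrakk>f \<in> graded_hom R X X' n; x \<in> carrier (X p); p - n = q\<rbrakk> \<Longrightarrow> f p x \<in> carrier (X' q)"
  by (auto simp: graded_hom_def linear_maps_def)

lemma graded_hom_add:
  "\<lbrakk>f \<in> graded_hom R X X' n; x \<in> carrier (X p); y \<in> carrier (X p); p - n = q\<rbrakk>
    \<Longrightarrow> f p (x \<oplus>\<^bsub>X p\<^esub> y) = f p x \<oplus>\<^bsub>X' q\<^esub> f p y"
  by (auto simp: graded_hom_def linear_maps_def)

lemma graded_hom_smult:
  "\<lbrakk>f \<in> graded_hom R X X' n; a \<in> carrier R; x \<in> carrier (X p); p - n = q\<rbrakk>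
    \<Longrightarrow> f p (a \<odot>\<^bsub>X p\<^esub> x) = a \<odot>\<^bsub>X' q\<^esub> f p x"
  by (auto simp: graded_hom_def linear_maps_def)

lemma graded_hom_finsum:
  assumes "f \<in> graded_hom R X X' n" "p - n = q" "finite I" "\<And>i. i \<in> I \<Longrightarrow> g i \<in> carrier (X p)"
  shows "f p (\<Oplus>\<^bsub>X p\<^esub>i\<in>I. g i) = (\<Oplus>\<^bsub>X' q\<^esub>i\<in>I. f p (g i))"
  using assms
  by (intro additive_finsum component_abelian_group X'.component_abelian_group)
    (auto intro: graded_hom_closed graded_hom_add)

lemma graded_hom_zero:
  assumes "f \<in> graded_hom R X X' n" "p - n = q"
  shows "f p \<zero>\<^bsub>X p\<^esub> = \<zero>\<^bsub>X' q\<^esub>"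
  using graded_hom_finsum[OF assms, of "{}" undefined] by simp

lemma graded_hom_a_inv:
  assumes "f \<in> graded_hom R X X' n" "x \<in> carrier (X p)" "p - n = q"
  shows "f p (\<ominus>\<^bsub>X p\<^esub> x) = \<ominus>\<^bsub>X' q\<^esub> f p x"
proof -
  have "f p (\<ominus>\<^bsub>X p\<^esub> x) \<oplus>\<^bsub>X' q\<^esub> f p x = \<zero>\<^bsub>X' q\<^esub>"
    using graded_hom_add[OF assms(1) _ assms(2,3), of "\<ominus>\<^bsub>X p\<^esub> x"] assms
    by (simp add: M.l_neg graded_hom_zero)
  then show ?thesis
    using assms by (intro X'.M.minus_equality[symmetric]) (auto intro: graded_hom_closed)
qed

end

context graded_module
begin

sublocale endo: graded_module_pair R X X
  by unfold_locales

lemma component_smult_closed: "\<lbrakk>a \<in> carrier R; x \<in> carrier (X p)\<rbrakk> \<Longrightarrow> a \<odot>\<^bsub>X p\<^esub> x \<in> carrier (X p)"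
  using component_module by (rule left_module.smult_closed)

lemma component_smult_add:
  "\<lbrakk>a \<in> carrier R; x \<in> carrier (X p); y \<in> carrier (X p)\<rbrakk>
    \<Longrightarrow> a \<odot>\<^bsub>X p\<^esub> (x \<oplus>\<^bsub>X p\<^esub> y) = a \<odot>\<^bsub>X p\<^esub> x \<oplus>\<^bsub>X p\<^esub> a \<odot>\<^bsub>X p\<^esub> y"
  using component_module by (rule left_module.smult_r_distr)

lemma component_smult_finsum:
  assumes "a \<in> carrier R" "finite I" "\<And>i. i \<in> I \<Longrightarrow> g i \<in> carrier (X p)"
  shows "a \<odot>\<^bsub>X p\<^esub> (\<Oplus>\<^bsub>X p\<^esub>i\<in>I. g i) = (\<Oplus>\<^bsub>X p\<^esub>i\<in>I. a \<odot>\<^bsub>X p\<^esub> g i)"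
  using assms
  by (intro additive_finsum component_abelian_group)
    (auto intro: component_smult_closed component_smult_add)

lemma component_smult_zero: "a \<in> carrier R \<Longrightarrow> a \<odot>\<^bsub>X p\<^esub> \<zero>\<^bsub>X p\<^esub> = \<zero>\<^bsub>X p\<^esub>"
  using component_smult_finsum[of a "{}" undefined] by simp

lemma component_smult_a_inv:
  assumes "a \<in> carrier R" "x \<in> carrier (X p)"
  shows "a \<odot>\<^bsub>X p\<^esub> (\<ominus>\<^bsub>X p\<^esub> x) = \<ominus>\<^bsub>X p\<^esub> (a \<odot>\<^bsub>X p\<^esub> x)"
proof -
  have "a \<odot>\<^bsub>X p\<^esub> (\<ominus>\<^bsub>X p\<^esub> x) \<oplus>\<^bsub>X p\<^esub> a \<odot>\<^bsub>X p\<^esub> x = \<zero>\<^bsub>X p\<^esub>"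
    using assms by (simp flip: component_smult_add add: M.l_neg component_smult_zero)
  then show ?thesis
    using assms by (intro M.minus_equality[symmetric]) (auto intro: component_smult_closed)
qed

lemma finsum_a_inv:
  assumes "finite I" "\<And>i. i \<in> I \<Longrightarrow> g i \<in> carrier (X p)"
  shows "\<ominus>\<^bsub>X p\<^esub> (\<Oplus>\<^bsub>X p\<^esub>i\<in>I. g i) = (\<Oplus>\<^bsub>X p\<^esub>i\<in>I. \<ominus>\<^bsub>X p\<^esub> g i)"
  using assms by (intro additive_finsum component_abelian_group) (auto simp: M.minus_add)

section \<open>The endomorphism ring of a graded module\<close>

abbreviation "E \<equiv> End_alg R X"

abbreviation support :: "(int \<Rightarrow> int \<Rightarrow> 'b \<Rightarrow> 'b) \<Rightarrow> int set"
  where "support y \<equiv> {n. y n \<noteq> graded_zero X n}"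

lemma End_graded_hom: "y \<in> carrier E \<Longrightarrow> y n \<in> graded_hom R X X n"
  and End_finite_support: "y \<in> carrier E \<Longrightarrow> finite (support y)"
  by (simp_all add: End_alg_def)

lemma graded_zero_apply: "\<lbrakk>x \<in> carrier (X p); p - n = q\<rbrakk> \<Longrightarrow> graded_zero X n p x = \<zero>\<^bsub>X q\<^esub>"
  by (auto simp: graded_zero_def)

lemma graded_zero_graded_hom: "graded_zero X n \<in> graded_hom R X X n"
  by (auto simp: graded_hom_def linear_maps_def graded_zero_def M.add.m_closed
      component_smult_closed component_smult_zero)

lemma graded_hom_eqI:
  assumes "f \<in> graded_hom R X X n" "g \<in> graded_hom R X X n"
    and "\<And>q x. x \<in> carrier (X (q + n)) \<Longrightarrow> f (q + n) x = g (q + n) x"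
  shows "f = g"
proof
  fix p
  have "f p \<in> extensional (carrier (X p))" "g p \<in> extensional (carrier (X p))"
    using assms(1,2) by (auto simp: graded_hom_def linear_maps_def PiE_def)
  then show "f p = g p"
    using assms(3)[of _ "p - n"] by (intro extensionalityI[of _ "carrier (X p)"]) auto
qed

lemma End_eqI:
  assumes "y \<in> carrier E" "z \<in> carrier E"
    and "\<And>n q x. x \<in> carrier (X (q + n)) \<Longrightarrow> y n (q + n) x = z n (q + n) x"
  shows "y = z"
  using assms by (intro ext[of y z] graded_hom_eqI) (auto intro: End_graded_hom)

lemma End_apply_closed:
  "\<lbrakk>y \<in> carrier E; x \<in> carrier (X p); p - n = q\<rbrakk> \<Longrightarrow> y n p x \<in> carrier (X q)"
  by (rule endo.graded_hom_closed[OF End_graded_hom])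

text \<open>
  In the definition of the product the summation runs over the support of the left factor, which
  changes in sums and products of elements.  Any larger finite index set gives the same value, so
  several such sums can be brought to a common index set.
\<close>

lemma End_mult_apply:
  assumes y: "y \<in> carrier E" and z: "z \<in> carrier E" and K: "finite K" "support y \<subseteq> K"
    and v: "v \<in> carrier (X (q + n))"
  shows "(y \<otimes>\<^bsub>E\<^esub> z) n (q + n) v = (\<Oplus>\<^bsub>X q\<^esub>k\<in>K. y k (q + k) (z (n - k) (q + n) v))"
proof -
  have zc: "z (n - k) (q + n) v \<in> carrier (X (q + k))" for k
    using z v by (rule End_apply_closed) simp
  have *: "q + n - (n - k) = q + k" for k by simp
  have "(y \<otimes>\<^bsub>E\<^esub> z) n (q + n) v = (\<Oplus>\<^bsub>X q\<^esub>k\<in>support y. y k (q + k) (z (n - k) (q + n) v))"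
    using v unfolding End_alg_def by (simp add: *)
  also have "\<dots> = (\<Oplus>\<^bsub>X q\<^esub>k\<in>K. y k (q + k) (z (n - k) (q + n) v))"
    using K zc y
    by (intro M.add.finprod_mono_neutral_cong_left)
      (auto simp: Pi_def graded_zero_apply intro: End_apply_closed)
  finally show ?thesis .
qed

lemma End_add_apply:
  "\<lbrakk>v \<in> carrier (X p); p - n = q\<rbrakk> \<Longrightarrow> (y \<oplus>\<^bsub>E\<^esub> z) n p v = y n p v \<oplus>\<^bsub>X q\<^esub> z n p v"
  by (auto simp: End_alg_def)

lemma End_zero: "\<zero>\<^bsub>E\<^esub> = graded_zero X"
  by (simp add: End_alg_def)

lemma End_one_apply:
  "\<lbrakk>v \<in> carrier (X p); p - n = q\<rbrakk> \<Longrightarrow> \<one>\<^bsub>E\<^esub> n p v = (if n = 0 then v else \<zero>\<^bsub>X q\<^esub>)"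
  by (auto simp: End_alg_def graded_zero_apply)

lemma End_add_closed:
  assumes y: "y \<in> carrier E" and z: "z \<in> carrier E"
  shows "y \<oplus>\<^bsub>E\<^esub> z \<in> carrier E"
proof -
  have "(y \<oplus>\<^bsub>E\<^esub> z) n \<in> graded_hom R X X n" for n
  proof (rule endo.graded_homI)
    note hom = End_graded_hom[OF y, of n] End_graded_hom[OF z, of n]
    note [simp] = hom[THEN endo.graded_hom_closed] End_add_apply[where q = q for q]
    show "(y \<oplus>\<^bsub>E\<^esub> z) n p \<in> extensional (carrier (X p))" for p
      by (simp add: End_alg_def)
    fix q x assume x: "x \<in> carrier (X (q + n))"
    then show "(y \<oplus>\<^bsub>E\<^esub> z) n (q + n) x \<in> carrier (X q)" by simp
    show "(y \<oplus>\<^bsub>E\<^esub> z) n (q + n) (x \<oplus>\<^bsub>X (q + n)\<^esub> w)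
        = (y \<oplus>\<^bsub>E\<^esub> z) n (q + n) x \<oplus>\<^bsub>X q\<^esub> (y \<oplus>\<^bsub>E\<^esub> z) n (q + n) w"
      if "w \<in> carrier (X (q + n))" for w
      using x that hom[THEN endo.graded_hom_add, of x "q + n" w q] by (simp add: M.a_ac)
    show "(y \<oplus>\<^bsub>E\<^esub> z) n (q + n) (a \<odot>\<^bsub>X (q + n)\<^esub> x) = a \<odot>\<^bsub>X q\<^esub> (y \<oplus>\<^bsub>E\<^esub> z) n (q + n) x"
      if "a \<in> carrier R" for a
      using x that hom[THEN endo.graded_hom_smult, of a x "q + n" q]
      by (simp add: component_smult_closed component_smult_add)
  qed
  moreover have "support (y \<oplus>\<^bsub>E\<^esub> z) \<subseteq> support y \<union> support z"
  proof -
    have "(y \<oplus>\<^bsub>E\<^esub> z) n = graded_zero X n" if "y n = graded_zero X n" "z n = graded_zero X n" for n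
      using that by (simp add: End_alg_def graded_zero_def fun_eq_iff restrict_def)
    then show ?thesis by blast
  qed
  then have "finite (support (y \<oplus>\<^bsub>E\<^esub> z))"
    using End_finite_support[OF y] End_finite_support[OF z] by (simp add: finite_subset)
  ultimately show ?thesis by (simp add: End_alg_def[of R X])
qed

definition negation :: "(int \<Rightarrow> int \<Rightarrow> 'b \<Rightarrow> 'b) \<Rightarrow> int \<Rightarrow> int \<Rightarrow> 'b \<Rightarrow> 'b"
  where "negation y = (\<lambda>n p. \<lambda>x\<in>carrier (X p). \<ominus>\<^bsub>X (p - n)\<^esub> y n p x)"

definition parity :: "(int \<Rightarrow> int \<Rightarrow> 'b \<Rightarrow> 'b) \<Rightarrow> int \<Rightarrow> int \<Rightarrow> 'b \<Rightarrow> 'b"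
  where "parity y = (\<lambda>n. if even n then y n else negation y n)"

lemma support_negation: "support (negation y) \<subseteq> support y"
proof -
  have "negation y n = graded_zero X n" if "y n = graded_zero X n" for n
    using that by (simp add: negation_def graded_zero_def fun_eq_iff restrict_def)
  then show ?thesis by blast
qed

lemma support_parity: "support (parity y) \<subseteq> support y"
  using support_negation by (auto simp: parity_def)

lemma negation_apply:
  "\<lbrakk>v \<in> carrier (X p); p - n = q\<rbrakk> \<Longrightarrow> negation y n p v = \<ominus>\<^bsub>X q\<^esub> y n p v"
  by (auto simp: negation_def)

lemma negation_graded_hom:
  assumes y: "y \<in> carrier E" shows "negation y n \<in> graded_hom R X X n"
proof (rule endo.graded_homI)
  note hom = End_graded_hom[OF y, of n]
  note [simp] = hom[THEN endo.graded_hom_closed] negation_apply[where q = q for q]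
  show "negation y n p \<in> extensional (carrier (X p))" for p
    by (simp add: negation_def)
  fix q x assume x: "x \<in> carrier (X (q + n))"
  then show "negation y n (q + n) x \<in> carrier (X q)" by simp
  show "negation y n (q + n) (x \<oplus>\<^bsub>X (q + n)\<^esub> w) = negation y n (q + n) x \<oplus>\<^bsub>X q\<^esub> negation y n (q + n) w"
    if "w \<in> carrier (X (q + n))" for w
    using x that hom[THEN endo.graded_hom_add, of x "q + n" w q] by (simp add: M.minus_add)
  show "negation y n (q + n) (a \<odot>\<^bsub>X (q + n)\<^esub> x) = a \<odot>\<^bsub>X q\<^esub> negation y n (q + n) x"
    if "a \<in> carrier R" for a
    using x that hom[THEN endo.graded_hom_smult, of a x "q + n" q]
    by (simp add: component_smult_closed component_smult_a_inv)
qed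

lemma negation_closed: "y \<in> carrier E \<Longrightarrow> negation y \<in> carrier E"
  using finite_subset[OF support_negation[of y] End_finite_support[of y]]
  by (simp add: End_alg_def[of R X] negation_graded_hom)

lemma parity_closed: "y \<in> carrier E \<Longrightarrow> parity y \<in> carrier E"
  using finite_subset[OF support_parity[of y] End_finite_support[of y]]
    negation_graded_hom[of y] End_graded_hom[of y]
  by (auto simp: End_alg_def[of R X] parity_def)

lemma parity_apply:
  "\<lbrakk>v \<in> carrier (X p); p - n = q\<rbrakk> \<Longrightarrow> parity y n p v = (if even n then y n p v else \<ominus>\<^bsub>X q\<^esub> y n p v)"
  by (auto simp: parity_def negation_def)

lemma End_mult_graded_hom:
  assumes y: "y \<in> carrier E" and z: "z \<in> carrier E"
  shows "(y \<otimes>\<^bsub>E\<^esub> z) n \<in> graded_hom R X X n"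
proof (rule endo.graded_homI)
  note fin = End_finite_support[OF y]
  note app = End_mult_apply[OF y z fin subset_refl]
  note zh = End_graded_hom[OF z] and yh = End_graded_hom[OF y]
  have zc: "z (n - k) (q + n) v \<in> carrier (X (q + k))" if "v \<in> carrier (X (q + n))" for k q v
    using z that by (rule End_apply_closed) simp
  have yc: "y k (q + k) v \<in> carrier (X q)" if "v \<in> carrier (X (q + k))" for k q v
    using y that by (rule End_apply_closed) simp
  show "(y \<otimes>\<^bsub>E\<^esub> z) n p \<in> extensional (carrier (X p))" for p
    by (simp add: End_alg_def)
  fix q u assume u: "u \<in> carrier (X (q + n))"
  then show "(y \<otimes>\<^bsub>E\<^esub> z) n (q + n) u \<in> carrier (X q)"
    by (auto simp: app Pi_def intro!: M.finsum_closed zc yc)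
  show "(y \<otimes>\<^bsub>E\<^esub> z) n (q + n) (u \<oplus>\<^bsub>X (q + n)\<^esub> v)
      = (y \<otimes>\<^bsub>E\<^esub> z) n (q + n) u \<oplus>\<^bsub>X q\<^esub> (y \<otimes>\<^bsub>E\<^esub> z) n (q + n) v"
    if v: "v \<in> carrier (X (q + n))" for v
  proof -
    have "y k (q + k) (z (n - k) (q + n) (u \<oplus>\<^bsub>X (q + n)\<^esub> v))
      = y k (q + k) (z (n - k) (q + n) u) \<oplus>\<^bsub>X q\<^esub> y k (q + k) (z (n - k) (q + n) v)" for k
      using u v by (simp add: endo.graded_hom_add[OF zh, where q = "q + k"]
          endo.graded_hom_add[OF yh, where q = q] zc)
    then show ?thesis
      using u v by (simp add: app zc yc M.finsum_addf Pi_def)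
  qed
  show "(y \<otimes>\<^bsub>E\<^esub> z) n (q + n) (a \<odot>\<^bsub>X (q + n)\<^esub> u) = a \<odot>\<^bsub>X q\<^esub> (y \<otimes>\<^bsub>E\<^esub> z) n (q + n) u"
    if a: "a \<in> carrier R" for a
  proof -
    have "y k (q + k) (z (n - k) (q + n) (a \<odot>\<^bsub>X (q + n)\<^esub> u))
      = a \<odot>\<^bsub>X q\<^esub> y k (q + k) (z (n - k) (q + n) u)" for k
      using u a by (simp add: endo.graded_hom_smult[OF zh, where q = "q + k"]
          endo.graded_hom_smult[OF yh, where q = q] zc)
    then show ?thesis
      using u a fin by (simp add: app zc yc component_smult_closed component_smult_finsum)
  qed
qed

text \<open>
  A nonzero component of a product has a degree \<open>i + j\<close> with \<open>i\<close> and \<open>j\<close> in the supports of the factors.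
\<close>

lemma support_mult_finite:
  assumes y: "y \<in> carrier E" and z: "z \<in> carrier E"
  shows "finite (support (y \<otimes>\<^bsub>E\<^esub> z))"
proof -
  have "n \<in> (\<lambda>(i, j). i + j) ` (support y \<times> support z)" if n: "n \<in> support (y \<otimes>\<^bsub>E\<^esub> z)" for n
  proof (rule ccontr)
    assume not: "n \<notin> (\<lambda>(i, j). i + j) ` (support y \<times> support z)"
    have "(y \<otimes>\<^bsub>E\<^esub> z) n (q + n) v = graded_zero X n (q + n) v"
      if v: "v \<in> carrier (X (q + n))" for q v
    proof -
      have "y k (q + k) (z (n - k) (q + n) v) = \<zero>\<^bsub>X q\<^esub>" if "k \<in> support y" for k
      proof -
        have "n - k \<notin> support z"
        proof
          assume "n - k \<in> support z"
          with that have "n \<in> (\<lambda>(i, j). i + j) ` (support y \<times> support z)"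
            by (intro image_eqI[of _ _ "(k, n - k)"]) simp_all
          with not show False ..
        qed
        then show ?thesis
          using v by (simp add: graded_zero_apply[where q = "q + k"]
              endo.graded_hom_zero[OF End_graded_hom[OF y], where q = q])
      qed
      then have "(\<Oplus>\<^bsub>X q\<^esub>k\<in>support y. y k (q + k) (z (n - k) (q + n) v))
          = (\<Oplus>\<^bsub>X q\<^esub>k\<in>support y. \<zero>\<^bsub>X q\<^esub>)"
        by (intro M.finsum_cong') auto
      then show ?thesis
        using v End_finite_support[OF y]
        by (simp add: End_mult_apply[OF y z _ subset_refl] graded_zero_apply)
    qed
    then have "(y \<otimes>\<^bsub>E\<^esub> z) n = graded_zero X n"
      by (rule graded_hom_eqI[OF End_mult_graded_hom[OF y z] graded_zero_graded_hom])
    then show False using n by simp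
  qed
  then have "support (y \<otimes>\<^bsub>E\<^esub> z) \<subseteq> (\<lambda>(i, j). i + j) ` (support y \<times> support z)" by blast
  then show ?thesis
    by (rule finite_subset) (simp add: End_finite_support y z)
qed

lemma End_mult_closed: "\<lbrakk>y \<in> carrier E; z \<in> carrier E\<rbrakk> \<Longrightarrow> y \<otimes>\<^bsub>E\<^esub> z \<in> carrier E"
  using End_mult_graded_hom support_mult_finite by (simp add: End_alg_def[of R X])

definition homogeneous :: "int \<Rightarrow> (int \<Rightarrow> 'b \<Rightarrow> 'b) \<Rightarrow> int \<Rightarrow> int \<Rightarrow> 'b \<Rightarrow> 'b"
  where "homogeneous n f = (graded_zero X)(n := f)"

lemma homogeneous_same [simp]: "homogeneous n f n = f"
  by (simp add: homogeneous_def)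

lemma support_homogeneous: "support (homogeneous n f) \<subseteq> {n}"
  by (auto simp: homogeneous_def)

lemma homogeneous_closed: "f \<in> graded_hom R X X n \<Longrightarrow> homogeneous n f \<in> carrier E"
  using finite_subset[OF support_homogeneous[of n f]]
  by (auto simp: End_alg_def homogeneous_def graded_zero_graded_hom)

lemma homogeneous_apply:
  "\<lbrakk>v \<in> carrier (X p); p - m = q\<rbrakk> \<Longrightarrow>
    homogeneous n f m p v = (if m = n then f p v else \<zero>\<^bsub>X q\<^esub>)"
  by (auto simp: homogeneous_def graded_zero_apply)

lemma homogeneous_mult_apply:
  assumes f: "f \<in> graded_hom R X X n" and y: "y \<in> carrier E" and v: "v \<in> carrier (X (q + m))"
  shows "(homogeneous n f \<otimes>\<^bsub>E\<^esub> y) m (q + m) v = f (q + n) (y (m - n) (q + m) v)"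
proof -
  have "y (m - n) (q + m) v \<in> carrier (X (q + n))"
    using y v by (rule End_apply_closed) simp
  moreover from this have "f (q + n) (y (m - n) (q + m) v) \<in> carrier (X q)"
    by (rule endo.graded_hom_closed[OF f]) simp
  ultimately show ?thesis
    using End_mult_apply[OF homogeneous_closed[OF f] y _ support_homogeneous v]
    by simp
qed

lemma mult_homogeneous_apply:
  assumes f: "f \<in> graded_hom R X X n" and y: "y \<in> carrier E" and v: "v \<in> carrier (X (q + m))"
  shows "(y \<otimes>\<^bsub>E\<^esub> homogeneous n f) m (q + m) v = y (m - n) (q + m - n) (f (q + m) v)"
proof -
  \<comment> \<open>Only the index \<open>m - n\<close> contributes, and it need not lie in the support of \<open>y\<close>.\<close>
  let ?K = "insert (m - n) (support y)"
  have fv: "f (q + m) v \<in> carrier (X (q + m - n))" using f v by (rule endo.graded_hom_closed) simp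
  have yf: "y (m - n) (q + m - n) (f (q + m) v) \<in> carrier (X q)"
    using y fv by (rule End_apply_closed) simp
  have "(y \<otimes>\<^bsub>E\<^esub> homogeneous n f) m (q + m) v
      = (\<Oplus>\<^bsub>X q\<^esub>k\<in>?K. y k (q + k) (homogeneous n f (m - k) (q + m) v))"
    using End_finite_support[OF y]
    by (intro End_mult_apply[OF y homogeneous_closed[OF f]] v) auto
  also have "\<dots> = (\<Oplus>\<^bsub>X q\<^esub>k\<in>?K. if m - n = k then y (m - n) (q + m - n) (f (q + m) v) else \<zero>\<^bsub>X q\<^esub>)"
    using v yf
    by (intro M.finsum_cong') (auto simp: homogeneous_apply[where q = "q + k" for k] add_diff_eq
        endo.graded_hom_zero[OF End_graded_hom[OF y], where q = q])
  also have "\<dots> = y (m - n) (q + m - n) (f (q + m) v)"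
    using End_finite_support[OF y] yf by (intro M.finsum_singleton) auto
  finally show ?thesis .
qed

lemma End_mult_apply_closed:
  assumes "y \<in> carrier E" "z \<in> carrier E" "v \<in> carrier (X (q + n))"
  shows "z (n - k) (q + n) v \<in> carrier (X (q + k))"
    and "y k (q + k) (z (n - k) (q + n) v) \<in> carrier (X q)"
proof -
  show *: "z (n - k) (q + n) v \<in> carrier (X (q + k))"
    using assms(2,3) by (rule End_apply_closed) simp
  show "y k (q + k) (z (n - k) (q + n) v) \<in> carrier (X q)"
    using assms(1) * by (rule End_apply_closed) simp
qed

lemma component_minus_zero: "\<ominus>\<^bsub>X p\<^esub> \<zero>\<^bsub>X p\<^esub> = \<zero>\<^bsub>X p\<^esub>"
  by (rule M.minus_equality) simp_all

lemma graded_zero_closed: "graded_zero X \<in> carrier E"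
  by (simp add: End_alg_def[of R X] graded_zero_graded_hom)

lemmas End_zero_closed = graded_zero_closed[folded End_zero]

lemma End_one_closed: "\<one>\<^bsub>E\<^esub> \<in> carrier E"
proof -
  have "(\<lambda>p. \<lambda>x\<in>carrier (X p). x) \<in> graded_hom R X X 0"
    by (rule endo.graded_homI) (simp_all add: component_smult_closed)
  then have "homogeneous 0 (\<lambda>p. \<lambda>x\<in>carrier (X p). x) \<in> carrier E" by (rule homogeneous_closed)
  moreover have "homogeneous 0 (\<lambda>p. \<lambda>x\<in>carrier (X p). x) = \<one>\<^bsub>E\<^esub>"
    by (simp add: homogeneous_def End_alg_def fun_eq_iff)
  ultimately show ?thesis by simp
qed

text \<open>
  Both sides are the double sum of \<open>x\<^sub>i y\<^sub>j z\<^sub>n\<^sub>-\<^sub>i\<^sub>-\<^sub>j\<close>.  On the left it is indexed by \<open>i\<close> and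
  \<open>k = i + j\<close>, on the right by \<open>i\<close> and \<open>j\<close>.
\<close>

lemma End_mult_assoc:
  assumes x: "x \<in> carrier E" and y: "y \<in> carrier E" and z: "z \<in> carrier E"
  shows "x \<otimes>\<^bsub>E\<^esub> y \<otimes>\<^bsub>E\<^esub> z = x \<otimes>\<^bsub>E\<^esub> (y \<otimes>\<^bsub>E\<^esub> z)"
proof (rule End_eqI)
  have xy: "x \<otimes>\<^bsub>E\<^esub> y \<in> carrier E" and yz: "y \<otimes>\<^bsub>E\<^esub> z \<in> carrier E"
    using assms by (simp_all add: End_mult_closed)
  show "x \<otimes>\<^bsub>E\<^esub> y \<otimes>\<^bsub>E\<^esub> z \<in> carrier E" "x \<otimes>\<^bsub>E\<^esub> (y \<otimes>\<^bsub>E\<^esub> z) \<in> carrier E"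
    using assms xy yz by (simp_all add: End_mult_closed)
  fix n q v assume v: "v \<in> carrier (X (q + n))"
  define I where "I = support x"
  \<comment> \<open>One index set for \<open>k\<close> that serves the product \<open>x y\<close> and whose translates by \<open>-i\<close> serve \<open>y\<close>.\<close>
  define K where "K = support (x \<otimes>\<^bsub>E\<^esub> y) \<union> (\<lambda>(i, j). i + j) ` (support x \<times> support y)"
  have I: "finite I" "support x \<subseteq> I"
    using End_finite_support[OF x] by (simp_all add: I_def)
  have K: "finite K" "support (x \<otimes>\<^bsub>E\<^esub> y) \<subseteq> K"
    using assms xy End_finite_support by (simp_all add: K_def)
  have Ky: "support y \<subseteq> (\<lambda>k. k - i) ` K" if "i \<in> I" for i
  proof
    fix j assume "j \<in> support y"
    with that have "i + j \<in> K" by (force simp: I_def K_def)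
    then show "j \<in> (\<lambda>k. k - i) ` K" by (rule rev_image_eqI) simp
  qed
  let ?t = "\<lambda>i k. x i (q + i) (y (k - i) (q + k) (z (n - k) (q + n) v))"
  note zc = End_mult_apply_closed(1)[OF y z v]
  have yc: "y (k - i) (q + k) (z (n - k) (q + n) v) \<in> carrier (X (q + i))" for i k
    using y zc by (rule End_apply_closed) simp
  have tc: "?t i k \<in> carrier (X q)" for i k
    using x yc by (rule End_apply_closed) simp
  have "(x \<otimes>\<^bsub>E\<^esub> y \<otimes>\<^bsub>E\<^esub> z) n (q + n) v
      = (\<Oplus>\<^bsub>X q\<^esub>k\<in>K. (x \<otimes>\<^bsub>E\<^esub> y) k (q + k) (z (n - k) (q + n) v))"
    by (rule End_mult_apply[OF xy z K v])
  also have "\<dots> = (\<Oplus>\<^bsub>X q\<^esub>k\<in>K. \<Oplus>\<^bsub>X q\<^esub>i\<in>I. ?t i k)"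
    by (simp add: End_mult_apply[OF x y I zc])
  also have "\<dots> = (\<Oplus>\<^bsub>X q\<^esub>i\<in>I. \<Oplus>\<^bsub>X q\<^esub>k\<in>K. ?t i k)"
    using I K tc by (intro M.finsum_swap)
  also have "\<dots> = (\<Oplus>\<^bsub>X q\<^esub>i\<in>I. x i (q + i) ((y \<otimes>\<^bsub>E\<^esub> z) (n - i) (q + n) v))"
  proof (rule M.finsum_cong')
    fix i assume i: "i \<in> I"
    have v': "v \<in> carrier (X (q + i + (n - i)))" using v by simp
    have ck: "y j (q + i + j) (z (n - i - j) (q + n) v) \<in> carrier (X (q + i))" for j
      using End_mult_apply_closed(2)[OF y z v'] by simp
    have "(y \<otimes>\<^bsub>E\<^esub> z) (n - i) (q + n) v
        = (\<Oplus>\<^bsub>X (q + i)\<^esub>j\<in>(\<lambda>k. k - i) ` K. y j (q + i + j) (z (n - i - j) (q + n) v))"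
      using End_mult_apply[OF y z _ Ky[OF i] v'] K by simp
    also have "\<dots> = (\<Oplus>\<^bsub>X (q + i)\<^esub>k\<in>K. y (k - i) (q + k) (z (n - k) (q + n) v))"
      using ck by (subst M.finsum_reindex) (auto simp: inj_on_def)
    finally show "(\<Oplus>\<^bsub>X q\<^esub>k\<in>K. ?t i k) = x i (q + i) ((y \<otimes>\<^bsub>E\<^esub> z) (n - i) (q + n) v)"
      using K yc by (simp add: endo.graded_hom_finsum[OF End_graded_hom[OF x], where q = q])
  qed (auto intro: End_mult_apply_closed(2)[OF x yz v])
  also have "\<dots> = (x \<otimes>\<^bsub>E\<^esub> (y \<otimes>\<^bsub>E\<^esub> z)) n (q + n) v"
    by (rule End_mult_apply[OF x yz I v, symmetric])
  finally show "(x \<otimes>\<^bsub>E\<^esub> y \<otimes>\<^bsub>E\<^esub> z) n (q + n) v = (x \<otimes>\<^bsub>E\<^esub> (y \<otimes>\<^bsub>E\<^esub> z)) n (q + n) v" .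
qed

lemma End_l_distr:
  assumes x: "x \<in> carrier E" and y: "y \<in> carrier E" and z: "z \<in> carrier E"
  shows "(x \<oplus>\<^bsub>E\<^esub> y) \<otimes>\<^bsub>E\<^esub> z = x \<otimes>\<^bsub>E\<^esub> z \<oplus>\<^bsub>E\<^esub> y \<otimes>\<^bsub>E\<^esub> z"
proof (rule End_eqI)
  note xy = End_add_closed[OF x y]
  show "(x \<oplus>\<^bsub>E\<^esub> y) \<otimes>\<^bsub>E\<^esub> z \<in> carrier E" "x \<otimes>\<^bsub>E\<^esub> z \<oplus>\<^bsub>E\<^esub> y \<otimes>\<^bsub>E\<^esub> z \<in> carrier E"
    using assms by (simp_all add: End_mult_closed End_add_closed)
  fix n q v assume v: "v \<in> carrier (X (q + n))"
  define K where "K = support (x \<oplus>\<^bsub>E\<^esub> y) \<union> support x \<union> support y"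
  have K: "finite K" "support (x \<oplus>\<^bsub>E\<^esub> y) \<subseteq> K" "support x \<subseteq> K" "support y \<subseteq> K"
    using End_finite_support[OF x] End_finite_support[OF y] End_finite_support[OF xy]
    by (auto simp: K_def)
  show "((x \<oplus>\<^bsub>E\<^esub> y) \<otimes>\<^bsub>E\<^esub> z) n (q + n) v = (x \<otimes>\<^bsub>E\<^esub> z \<oplus>\<^bsub>E\<^esub> y \<otimes>\<^bsub>E\<^esub> z) n (q + n) v"
    using v End_mult_apply_closed[OF x z v] End_mult_apply_closed[OF y z v]
    by (simp add: End_mult_apply[OF xy z K(1,2)] End_add_apply[where q = q]
        End_mult_apply[OF x z K(1,3)] End_mult_apply[OF y z K(1,4)] M.finsum_addf Pi_def)
qed

lemma End_r_distr:
  assumes x: "x \<in> carrier E" and y: "y \<in> carrier E" and z: "z \<in> carrier E"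
  shows "z \<otimes>\<^bsub>E\<^esub> (x \<oplus>\<^bsub>E\<^esub> y) = z \<otimes>\<^bsub>E\<^esub> x \<oplus>\<^bsub>E\<^esub> z \<otimes>\<^bsub>E\<^esub> y"
proof (rule End_eqI)
  note xy = End_add_closed[OF x y]
  show "z \<otimes>\<^bsub>E\<^esub> (x \<oplus>\<^bsub>E\<^esub> y) \<in> carrier E" "z \<otimes>\<^bsub>E\<^esub> x \<oplus>\<^bsub>E\<^esub> z \<otimes>\<^bsub>E\<^esub> y \<in> carrier E"
    using assms by (simp_all add: End_mult_closed End_add_closed)
  fix n q v assume v: "v \<in> carrier (X (q + n))"
  note fin = End_finite_support[OF z] subset_refl
  have "z k (q + k) ((x \<oplus>\<^bsub>E\<^esub> y) (n - k) (q + n) v)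
      = z k (q + k) (x (n - k) (q + n) v) \<oplus>\<^bsub>X q\<^esub> z k (q + k) (y (n - k) (q + n) v)" for k
    using v End_mult_apply_closed[OF z x v] End_mult_apply_closed[OF z y v]
    by (simp add: End_add_apply[where q = "q + k"]
        endo.graded_hom_add[OF End_graded_hom[OF z], where q = q])
  then show "(z \<otimes>\<^bsub>E\<^esub> (x \<oplus>\<^bsub>E\<^esub> y)) n (q + n) v = (z \<otimes>\<^bsub>E\<^esub> x \<oplus>\<^bsub>E\<^esub> z \<otimes>\<^bsub>E\<^esub> y) n (q + n) v"
    using v End_mult_apply_closed[OF z x v] End_mult_apply_closed[OF z y v]
    by (simp add: End_mult_apply[OF z xy fin] End_add_apply[where q = q]
        End_mult_apply[OF z x fin] End_mult_apply[OF z y fin] M.finsum_addf Pi_def)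
qed

lemma End_add_negation: "y \<in> carrier E \<Longrightarrow> negation y \<oplus>\<^bsub>E\<^esub> y = \<zero>\<^bsub>E\<^esub>"
  by (rule End_eqI)
    (simp_all add: negation_closed End_add_closed graded_zero_closed End_add_apply[where q = q for q]
      negation_apply[where q = q for q] End_zero graded_zero_apply[where q = q for q]
      End_apply_closed M.l_neg)

lemma End_ring: "ring E"
proof (rule ringI)
  show "abelian_group E"
  proof (rule abelian_groupI)
    fix x y z assume xyz: "x \<in> carrier E" "y \<in> carrier E" "z \<in> carrier E"
    note [simp] = End_add_closed graded_zero_closed End_add_apply[where q = q for q] End_zero
      graded_zero_apply[where q = q for q] End_apply_closed
    show "x \<oplus>\<^bsub>E\<^esub> y \<in> carrier E" using xyz by simp
    show "x \<oplus>\<^bsub>E\<^esub> y \<oplus>\<^bsub>E\<^esub> z = x \<oplus>\<^bsub>E\<^esub> (y \<oplus>\<^bsub>E\<^esub> z)"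
      using xyz by (intro End_eqI) (simp_all add: M.a_assoc)
    show "x \<oplus>\<^bsub>E\<^esub> y = y \<oplus>\<^bsub>E\<^esub> x"
      using xyz by (intro End_eqI) (simp_all add: M.a_comm)
    show "\<zero>\<^bsub>E\<^esub> \<oplus>\<^bsub>E\<^esub> x = x"
      using xyz by (intro End_eqI) simp_all
    show "\<exists>y\<in>carrier E. y \<oplus>\<^bsub>E\<^esub> x = \<zero>\<^bsub>E\<^esub>"
      using xyz negation_closed End_add_negation by blast
  qed (rule End_zero_closed)
  show "monoid E"
  proof (rule monoidI)
    have one: "homogeneous 0 (\<lambda>p. \<lambda>x\<in>carrier (X p). x) = \<one>\<^bsub>E\<^esub>"
      by (simp add: homogeneous_def End_alg_def fun_eq_iff)
    have hom: "(\<lambda>p. \<lambda>x\<in>carrier (X p). x) \<in> graded_hom R X X 0"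
      by (rule endo.graded_homI) (simp_all add: component_smult_closed)
    fix x assume x: "x \<in> carrier E"
    show "\<one>\<^bsub>E\<^esub> \<otimes>\<^bsub>E\<^esub> x = x"
    proof (rule End_eqI)
      fix n q v assume v: "v \<in> carrier (X (q + n))"
      then have "x n (q + n) v \<in> carrier (X q)" using x by (simp add: End_apply_closed)
      then show "(\<one>\<^bsub>E\<^esub> \<otimes>\<^bsub>E\<^esub> x) n (q + n) v = x n (q + n) v"
        using homogeneous_mult_apply[OF hom x v] by (simp add: one)
    qed (use x in \<open>simp_all add: End_mult_closed End_one_closed\<close>)
    show "x \<otimes>\<^bsub>E\<^esub> \<one>\<^bsub>E\<^esub> = x"
    proof (rule End_eqI)
      fix n q v assume v: "v \<in> carrier (X (q + n))"
      then show "(x \<otimes>\<^bsub>E\<^esub> \<one>\<^bsub>E\<^esub>) n (q + n) v = x n (q + n) v"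
        using mult_homogeneous_apply[OF hom x v] by (simp add: one)
    qed (use x in \<open>simp_all add: End_mult_closed End_one_closed\<close>)
  qed (simp_all add: End_mult_closed End_one_closed End_mult_assoc)
qed (simp_all add: End_l_distr End_r_distr)

sublocale E: ring E
  by (rule End_ring)

lemma End_a_inv: "y \<in> carrier E \<Longrightarrow> \<ominus>\<^bsub>E\<^esub> y = negation y"
  by (rule E.minus_equality) (simp_all add: End_add_negation negation_closed)

lemma End_minus_apply:
  "\<lbrakk>y \<in> carrier E; z \<in> carrier E; v \<in> carrier (X p); p - n = q\<rbrakk>
    \<Longrightarrow> (y \<ominus>\<^bsub>E\<^esub> z) n p v = y n p v \<ominus>\<^bsub>X q\<^esub> z n p v"
  by (simp add: a_minus_def End_a_inv End_add_apply negation_apply)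

lemma parity_parity: "y \<in> carrier E \<Longrightarrow> parity (parity y) = y"
  by (rule End_eqI) (simp_all add: parity_closed parity_apply[where q = q for q] End_apply_closed)

lemma parity_hom: "parity \<in> ring_hom E E"
proof (rule ring_hom_memI)
  note [simp] = End_add_apply[where q = q for q] parity_apply[where q = q for q]
    End_apply_closed parity_closed
  fix x y assume x: "x \<in> carrier E" and y: "y \<in> carrier E"
  show "parity x \<in> carrier E" using x by simp
  show "parity (x \<oplus>\<^bsub>E\<^esub> y) = parity x \<oplus>\<^bsub>E\<^esub> parity y"
    using x y by (intro End_eqI) (simp_all add: M.minus_add M.a_comm)
  note px = parity_closed[OF x] and py = parity_closed[OF y] and xy = E.m_closed[OF x y]
  show "parity (x \<otimes>\<^bsub>E\<^esub> y) = parity x \<otimes>\<^bsub>E\<^esub> parity y"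
  proof (rule End_eqI)
    fix n q v assume v: "v \<in> carrier (X (q + n))"
    note fin = End_finite_support[OF x]
    note c = End_mult_apply_closed[OF x y v]
    have "parity x k (q + k) (parity y (n - k) (q + n) v)
      = (if even n then x k (q + k) (y (n - k) (q + n) v)
         else \<ominus>\<^bsub>X q\<^esub> x k (q + k) (y (n - k) (q + n) v))" for k
      using v c[of k]
      by (auto simp: parity_apply[where q = "q + k"]
          endo.graded_hom_a_inv[OF End_graded_hom[OF x], where q = q])
    then show "parity (x \<otimes>\<^bsub>E\<^esub> y) n (q + n) v = (parity x \<otimes>\<^bsub>E\<^esub> parity y) n (q + n) v"
      using v c fin
      by (simp add: End_mult_apply[OF px py fin support_parity] End_mult_apply[OF x y fin subset_refl]
          finsum_a_inv)
  qed (use px py xy in simp_all)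
next
  show "parity \<one>\<^bsub>E\<^esub> = \<one>\<^bsub>E\<^esub>"
    by (rule End_eqI) (auto simp: parity_closed parity_apply[where q = q for q]
        End_one_apply[where q = q for q])
qed

end

section \<open>The endomorphism complex as a differential superring\<close>

context chain_complex
begin

lemma differential_closed: "homogeneous 1 d \<in> carrier E"
  using differential by (rule homogeneous_closed)

lemma End_diff_supercommutator:
  assumes y: "y \<in> carrier E"
  shows "End_diff X d y = homogeneous 1 d \<otimes>\<^bsub>E\<^esub> y \<ominus>\<^bsub>E\<^esub> parity y \<otimes>\<^bsub>E\<^esub> homogeneous 1 d"
    (is "_ = ?r")
proof (intro ext)
  fix n p v
  note py = parity_closed[OF y]
  have r: "?r \<in> carrier E" by (simp add: y py differential_closed)
  show "End_diff X d y n p v = ?r n p v"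
  proof (cases "v \<in> carrier (X p)")
    case True
    define q where "q = p - n"
    have p: "p = q + n" by (simp add: q_def)
    have v: "v \<in> carrier (X (q + n))" using True p by simp
    have dv: "d (q + n) v \<in> carrier (X (q + n - 1))"
      using differential v by (rule endo.graded_hom_closed) simp
    then have ydv: "y (n - 1) (q + n - 1) (d (q + n) v) \<in> carrier (X q)"
      by (rule End_apply_closed[OF y]) simp
    have "?r n (q + n) v = d (q + 1) (y (n - 1) (q + n) v)
        \<ominus>\<^bsub>X q\<^esub> parity y (n - 1) (q + n - 1) (d (q + n) v)"
      using v by (simp add: End_minus_apply[where q = q] y py differential_closed
          homogeneous_mult_apply[OF differential y] mult_homogeneous_apply[OF differential py])
    also have "parity y (n - 1) (q + n - 1) (d (q + n) v)
      = (if even (n - 1) then y (n - 1) (q + n - 1) (d (q + n) v)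
         else \<ominus>\<^bsub>X q\<^esub> y (n - 1) (q + n - 1) (d (q + n) v))"
      by (rule parity_apply[OF dv]) simp
    finally show ?thesis
      using v ydv by (simp add: p End_diff_def graded_diff_def a_minus_def add.commute)
  next
    case False
    have "?r n p \<in> extensional (carrier (X p))"
      using End_graded_hom[OF r, of n] by (auto simp: graded_hom_def linear_maps_def PiE_def)
    then show ?thesis
      using False by (simp add: End_diff_def graded_diff_def extensional_def)
  qed
qed

lemma differential_square_zero: "homogeneous 1 d \<otimes>\<^bsub>E\<^esub> homogeneous 1 d = \<zero>\<^bsub>E\<^esub>"
proof (rule End_eqI)
  fix n q v assume v: "v \<in> carrier (X (q + n))"
  have "d (q + 1) (homogeneous 1 d (n - 1) (q + n) v) = \<zero>\<^bsub>X q\<^esub>"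
  proof (cases "n = 2")
    case True
    then show ?thesis using v differential_squared[of v "q + 2"] by (simp add: homogeneous_def add.commute)
  next
    case False
    then show ?thesis
      using v by (simp add: homogeneous_apply[where q = "q + 1"]
          endo.graded_hom_zero[OF differential, where q = q])
  qed
  then show "(homogeneous 1 d \<otimes>\<^bsub>E\<^esub> homogeneous 1 d) n (q + n) v = \<zero>\<^bsub>E\<^esub> n (q + n) v"
    using v by (simp add: homogeneous_mult_apply[OF differential differential_closed] End_zero
        graded_zero_apply)
qed (simp_all add: differential_closed)

lemma differential_odd: "parity (homogeneous 1 d) = \<ominus>\<^bsub>E\<^esub> homogeneous 1 d"
  unfolding End_a_inv[OF differential_closed]
  by (rule End_eqI) (auto simp: parity_closed negation_closed differential_closed
      parity_apply[where q = q for q] negation_apply[where q = q for q] homogeneous_apply[where q = q for q]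
      component_minus_zero)

lemma End_differential_superring: "differential_superring E parity (End_diff X d)"
  using End_ring parity_hom parity_parity differential_closed differential_square_zero
    differential_odd End_diff_supercommutator
  by (rule supercommutator_differential_superring)

sublocale E: differential_superring E parity "End_diff X d"
  by (rule End_differential_superring)

lemma End_cocycles_eq: "End_cocycles R X d = E.cocycles"
  by (simp add: End_cocycles_def E.cocycles_def)

lemma End_cohomology_eq: "End_cohomology R X d = E.cohomology"
  by (simp add: End_cohomology_def E.cohomology_def E.cocycle_ring_def End_cocycles_eq
      End_coboundaries_def E.coboundaries_def)

lemma End_cohomology_deg_eq:
  "End_cohomology_deg R X d n
    = E.cohomology_class ` {z \<in> E.cocycles. \<forall>k. k \<noteq> n \<longrightarrow> z k = graded_zero X k}"
  by (auto simp: End_cohomology_deg_def E.cohomology_class_def End_cocycles_eq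
      End_coboundaries_def E.coboundaries_def)

end

section \<open>Conjugation by a homotopy equivalence\<close>

definition conjugate ::
    "(int \<Rightarrow> ('a, 'c, 'l) module_scheme) \<Rightarrow> (int \<Rightarrow> 'b \<Rightarrow> 'c) \<Rightarrow> (int \<Rightarrow> 'c \<Rightarrow> 'b)
      \<Rightarrow> (int \<Rightarrow> int \<Rightarrow> 'b \<Rightarrow> 'b) \<Rightarrow> int \<Rightarrow> int \<Rightarrow> 'c \<Rightarrow> 'c"
  where "conjugate X' F F' y = (\<lambda>n p. \<lambda>x\<in>carrier (X' p). F (p - n) (y n p (F' p x)))"

lemma conjugate_apply:
  "v \<in> carrier (X' (q + n)) \<Longrightarrow> conjugate X' F F' y n (q + n) v = F q (y n (q + n) (F' (q + n) v))"
  by (simp add: conjugate_def)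

lemma End_diff_apply:
  assumes "v \<in> carrier (X p)" "p - n = q"
  shows "End_diff X d y n p v =
    (if even (n - 1) then d (q + 1) (y (n - 1) p v) \<ominus>\<^bsub>X q\<^esub> y (n - 1) (p - 1) (d p v)
     else d (q + 1) (y (n - 1) p v) \<oplus>\<^bsub>X q\<^esub> y (n - 1) (p - 1) (d p v))"
proof -
  have "p - (n - 1) = q + 1" "p - (n - 1 + 1) = q" using assms(2) by simp_all
  then show ?thesis using assms(1)
    by (simp only: End_diff_def graded_diff_def restrict_apply' split: if_split)
qed

text \<open>
  The data are symmetric in the two complexes, so every fact about conjugation from \<open>X\<close> to \<open>X'\<close> also
  holds in the other direction, under the prefix \<open>reverse\<close> introduced below.
\<close>

locale chain_homotopy_equivalence =
  C: chain_complex R X d + C': chain_complex R X' d'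
  for R :: "('a, 'm) ring_scheme"
    and X :: "int \<Rightarrow> ('a, 'b, 'k) module_scheme" and d
    and X' :: "int \<Rightarrow> ('a, 'c, 'l) module_scheme" and d' +
  fixes F :: "int \<Rightarrow> 'b \<Rightarrow> 'c" and F' :: "int \<Rightarrow> 'c \<Rightarrow> 'b"
    and s :: "int \<Rightarrow> 'b \<Rightarrow> 'b" and s' :: "int \<Rightarrow> 'c \<Rightarrow> 'c"
  assumes F: "F \<in> chain_maps R X d X' d'" and F': "F' \<in> chain_maps R X' d' X d"
    and s: "s \<in> graded_hom R X X (-1)" and s': "s' \<in> graded_hom R X' X' (-1)"
    and homotopy: "x \<in> carrier (X p) \<Longrightarrow>
      F' p (F p x) \<ominus>\<^bsub>X p\<^esub> x = d (p + 1) (s p x) \<oplus>\<^bsub>X p\<^esub> s (p - 1) (d p x)"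
    and homotopy': "y \<in> carrier (X' p) \<Longrightarrow>
      F p (F' p y) \<ominus>\<^bsub>X' p\<^esub> y = d' (p + 1) (s' p y) \<oplus>\<^bsub>X' p\<^esub> s' (p - 1) (d' p y)"
begin

sublocale fwd: graded_module_pair R X X' by unfold_locales
sublocale bwd: graded_module_pair R X' X by unfold_locales

lemma F_graded_hom: "F \<in> graded_hom R X X' 0" and F'_graded_hom: "F' \<in> graded_hom R X' X 0"
  and F_comm: "x \<in> carrier (X p) \<Longrightarrow> F (p - 1) (d p x) = d' p (F p x)"
  and F'_comm: "y \<in> carrier (X' p) \<Longrightarrow> F' (p - 1) (d' p y) = d p (F' p y)"
  using F F' by (simp_all add: chain_maps_def)

lemma F_closed: "x \<in> carrier (X p) \<Longrightarrow> F p x \<in> carrier (X' p)"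
  by (rule fwd.graded_hom_closed[OF F_graded_hom]) simp_all

lemma F'_closed: "x \<in> carrier (X' p) \<Longrightarrow> F' p x \<in> carrier (X p)"
  by (rule bwd.graded_hom_closed[OF F'_graded_hom]) simp_all

abbreviation \<Phi> :: "(int \<Rightarrow> int \<Rightarrow> 'b \<Rightarrow> 'b) \<Rightarrow> int \<Rightarrow> int \<Rightarrow> 'c \<Rightarrow> 'c"
  where "\<Phi> \<equiv> conjugate X' F F'"

abbreviation S :: "int \<Rightarrow> int \<Rightarrow> 'b \<Rightarrow> 'b"
  where "S \<equiv> C.homogeneous (-1) s"

abbreviation round_trip :: "int \<Rightarrow> int \<Rightarrow> 'b \<Rightarrow> 'b"
  where "round_trip \<equiv> C.homogeneous 0 (\<lambda>p. \<lambda>x\<in>carrier (X p). F' p (F p x))"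

lemma round_trip_graded_hom: "(\<lambda>p. \<lambda>x\<in>carrier (X p). F' p (F p x)) \<in> graded_hom R X X 0"
  by (rule C.endo.graded_homI)
    (simp_all add: F_closed F'_closed C.component_smult_closed
      fwd.graded_hom_add[OF F_graded_hom] bwd.graded_hom_add[OF F'_graded_hom]
      fwd.graded_hom_smult[OF F_graded_hom] bwd.graded_hom_smult[OF F'_graded_hom])

lemma S_closed: "S \<in> carrier C.E"
  using s by (rule C.homogeneous_closed)

lemma round_trip_closed: "round_trip \<in> carrier C.E"
  using round_trip_graded_hom by (rule C.homogeneous_closed)

lemma round_trip_mult_apply:
  assumes "y \<in> carrier C.E" "v \<in> carrier (X (q + n))"
  shows "(round_trip \<otimes>\<^bsub>C.E\<^esub> y) n (q + n) v = F' q (F q (y n (q + n) v))"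
  using C.homogeneous_mult_apply[OF round_trip_graded_hom assms] C.End_apply_closed[OF assms, of n q]
  by simp

lemma mult_round_trip_apply:
  assumes "y \<in> carrier C.E" "v \<in> carrier (X (q + n))"
  shows "(y \<otimes>\<^bsub>C.E\<^esub> round_trip) n (q + n) v = y n (q + n) (F' (q + n) (F (q + n) v))"
  using C.mult_homogeneous_apply[OF round_trip_graded_hom assms] assms(2) by simp

text \<open>
  The homotopy \<open>s\<close> has degree \<open>-1\<close>, so its supercommutator with \<open>d\<close> is \<open>d s + s d\<close>, and the homotopy
  relation says that \<open>F' F = 1 + D s\<close> in the endomorphism ring.
\<close>

lemma round_trip_eq: "round_trip = \<one>\<^bsub>C.E\<^esub> \<oplus>\<^bsub>C.E\<^esub> End_diff X d S"
proof (rule C.End_eqI)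
  show "round_trip \<in> carrier C.E" by (rule round_trip_closed)
  show "\<one>\<^bsub>C.E\<^esub> \<oplus>\<^bsub>C.E\<^esub> End_diff X d S \<in> carrier C.E" by (simp add: S_closed)
  fix n q v assume v: "v \<in> carrier (X (q + n))"
  show "round_trip n (q + n) v = (\<one>\<^bsub>C.E\<^esub> \<oplus>\<^bsub>C.E\<^esub> End_diff X d S) n (q + n) v"
  proof (cases "n = 0")
    case True
    have v: "v \<in> carrier (X q)" using v True by simp
    then have dv: "d q v \<in> carrier (X (q - 1))"
      by (rule C.endo.graded_hom_closed[OF C.differential]) simp
    have "F' q (F q v) = v \<oplus>\<^bsub>X q\<^esub> (F' q (F q v) \<ominus>\<^bsub>X q\<^esub> v)"
      using v F_closed[OF v] F'_closed[OF F_closed[OF v]]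
      by (simp add: a_minus_def C.M.a_ac C.M.r_neg1 C.M.r_neg2)
    then show ?thesis
      using v dv True homotopy[OF v]
      by (simp add: C.End_add_apply[where q = q] C.End_one_apply[where q = q]
          End_diff_def graded_diff_def)
  next
    case False
    have dv: "d (q + n) v \<in> carrier (X (q + n - 1))"
      using v by (rule C.endo.graded_hom_closed[OF C.differential]) simp
    have "End_diff X d S n (q + n) v = \<zero>\<^bsub>X q\<^esub>"
      using v dv False
      by (simp add: End_diff_def graded_diff_def C.homogeneous_apply[where q = "q + 1"]
          C.homogeneous_apply[where q = q] C.endo.graded_hom_zero[OF C.differential, where q = q]
          a_minus_def add.commute)
    then show ?thesis
      using v False
      by (simp add: C.End_add_apply[where q = q] C.End_one_apply[where q = q]
          C.homogeneous_apply[where q = q])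
  qed
qed

lemma support_conjugate:
  assumes "y \<in> carrier C.E"
  shows "C'.support (\<Phi> y) \<subseteq> C.support y"
proof -
  have "\<Phi> y n = graded_zero X' n" if "y n = graded_zero X n" for n
    using that F'_closed
    by (simp add: conjugate_def graded_zero_def fun_eq_iff restrict_def
        fwd.graded_hom_zero[OF F_graded_hom])
  then show ?thesis by blast
qed

lemma conjugate_closed:
  assumes y: "y \<in> carrier C.E"
  shows "\<Phi> y \<in> carrier C'.E"
proof -
  have "\<Phi> y n \<in> graded_hom R X' X' n" for n
  proof (rule C'.endo.graded_homI)
    note yh = C.End_graded_hom[OF y, of n]
    note [simp] = F_closed F'_closed C.End_apply_closed[OF y] conjugate_apply
      C.component_smult_closed C'.component_smult_closed
      bwd.graded_hom_add[OF F'_graded_hom] fwd.graded_hom_add[OF F_graded_hom]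
      bwd.graded_hom_smult[OF F'_graded_hom] fwd.graded_hom_smult[OF F_graded_hom]
    fix q x assume x: "x \<in> carrier (X' (q + n))"
    show "\<Phi> y n (q + n) x \<in> carrier (X' q)" using x by simp
    show "\<Phi> y n (q + n) (x \<oplus>\<^bsub>X' (q + n)\<^esub> w) = \<Phi> y n (q + n) x \<oplus>\<^bsub>X' q\<^esub> \<Phi> y n (q + n) w"
      if "w \<in> carrier (X' (q + n))" for w
      using x that by (simp add: C.endo.graded_hom_add[OF yh, where q = q])
    show "\<Phi> y n (q + n) (a \<odot>\<^bsub>X' (q + n)\<^esub> x) = a \<odot>\<^bsub>X' q\<^esub> \<Phi> y n (q + n) x"
      if "a \<in> carrier R" for a
      using x that by (simp add: C.endo.graded_hom_smult[OF yh, where q = q])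
  qed (simp add: conjugate_def)
  moreover have "finite (C'.support (\<Phi> y))"
    using support_conjugate[OF y] C.End_finite_support[OF y] by (rule finite_subset)
  ultimately show ?thesis by (simp add: End_alg_def[of R X'])
qed

lemma conjugate_add:
  assumes x: "x \<in> carrier C.E" and y: "y \<in> carrier C.E"
  shows "\<Phi> (x \<oplus>\<^bsub>C.E\<^esub> y) = \<Phi> x \<oplus>\<^bsub>C'.E\<^esub> \<Phi> y"
  using assms
  by (intro C'.End_eqI)
    (simp_all add: conjugate_closed C'.End_add_apply[where q = q for q]
      C.End_add_apply[where q = q for q] conjugate_apply F'_closed C.End_apply_closed
      fwd.graded_hom_add[OF F_graded_hom, where q = q for q])

text \<open>
  Chain maps have degree \<open>0\<close> and commute with the differentials, so \<open>d' F y F' = F d y F'\<close> and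
  \<open>F y F' d' = F y d F'\<close>, with the same sign for both complexes.
\<close>

lemma conjugate_diff:
  assumes y: "y \<in> carrier C.E"
  shows "\<Phi> (End_diff X d y) = End_diff X' d' (\<Phi> y)"
proof (rule C'.End_eqI)
  show "\<Phi> (End_diff X d y) \<in> carrier C'.E" "End_diff X' d' (\<Phi> y) \<in> carrier C'.E"
    using y by (simp_all add: conjugate_closed)
  fix n q v assume v: "v \<in> carrier (X' (q + n))"
  define m where "m = n - 1"
  have d'v: "d' (q + n) v \<in> carrier (X' (q + m))"
    using v by (rule C'.endo.graded_hom_closed[OF C'.differential]) (simp add: m_def)
  have F'v: "F' (q + n) v \<in> carrier (X (q + n))" using v by (rule F'_closed)
  then have dF'v: "d (q + n) (F' (q + n) v) \<in> carrier (X (q + m))"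
    by (rule C.endo.graded_hom_closed[OF C.differential]) (simp add: m_def)
  have comm: "F' (q + m) (d' (q + n) v) = d (q + n) (F' (q + n) v)"
    using F'_comm[OF v] by (simp add: m_def add_diff_eq)
  have y1: "y m (q + n) (F' (q + n) v) \<in> carrier (X (q + 1))"
    using F'v by (rule C.End_apply_closed[OF y]) (simp add: m_def)
  then have dy1: "d (q + 1) (y m (q + n) (F' (q + n) v)) \<in> carrier (X q)"
    by (rule C.endo.graded_hom_closed[OF C.differential]) simp
  have y2: "y m (q + m) (d (q + n) (F' (q + n) v)) \<in> carrier (X q)"
    using dF'v by (rule C.End_apply_closed[OF y]) simp
  have a: "\<Phi> y m (q + n) v = F (q + 1) (y m (q + n) (F' (q + n) v))"
    using v by (simp add: conjugate_def m_def)
  have b: "\<Phi> y m (q + m) (d' (q + n) v) = F q (y m (q + m) (d (q + n) (F' (q + n) v)))"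
    using d'v by (simp add: conjugate_apply comm)
  have c: "d' (q + 1) (F (q + 1) (y m (q + n) (F' (q + n) v)))
      = F q (d (q + 1) (y m (q + n) (F' (q + n) v)))"
    using F_comm[OF y1] by simp
  have diff: "q + n - n = q" "q + n - 1 = q + m" by (simp_all add: m_def)
  show "\<Phi> (End_diff X d y) n (q + n) v = End_diff X' d' (\<Phi> y) n (q + n) v"
    using v F'v y2 dy1
    by (simp add: conjugate_apply End_diff_apply[where X = X' and q = q, OF v diff(1)]
        End_diff_apply[where X = X and q = q, OF F'v diff(1)]
        diff(2) m_def[symmetric] a b c a_minus_def
        fwd.graded_hom_add[OF F_graded_hom, where q = q]
        fwd.graded_hom_a_inv[OF F_graded_hom, where q = q])
qed

lemma conjugate_mult:
  assumes x: "x \<in> carrier C.E" and y: "y \<in> carrier C.E"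
  shows "\<Phi> x \<otimes>\<^bsub>C'.E\<^esub> \<Phi> y = \<Phi> (x \<otimes>\<^bsub>C.E\<^esub> round_trip \<otimes>\<^bsub>C.E\<^esub> y)"
proof (rule C'.End_eqI)
  note ry = C.E.m_closed[OF round_trip_closed y]
  note px = conjugate_closed[OF x] and py = conjugate_closed[OF y]
  show "\<Phi> x \<otimes>\<^bsub>C'.E\<^esub> \<Phi> y \<in> carrier C'.E" using px py by simp
  show "\<Phi> (x \<otimes>\<^bsub>C.E\<^esub> round_trip \<otimes>\<^bsub>C.E\<^esub> y) \<in> carrier C'.E"
    using x y round_trip_closed by (simp add: conjugate_closed)
  fix n q v assume v: "v \<in> carrier (X' (q + n))"
  note fin = C.End_finite_support[OF x]
  let ?w = "F' (q + n) v"
  have w: "?w \<in> carrier (X (q + n))" using v by (rule F'_closed)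
  note yw = C.End_mult_apply_closed(1)[OF x y w]
  have ry_apply: "(round_trip \<otimes>\<^bsub>C.E\<^esub> y) (n - k) (q + n) ?w
      = F' (q + k) (F (q + k) (y (n - k) (q + n) ?w))" for k
    using round_trip_mult_apply[OF y, of ?w "q + k" "n - k"] w by simp
  have py_apply: "\<Phi> y (n - k) (q + n) v = F (q + k) (y (n - k) (q + n) ?w)" for k
    using conjugate_apply[of v X' "q + k" "n - k"] v by simp
  have tc: "x k (q + k) (F' (q + k) (F (q + k) (y (n - k) (q + n) ?w))) \<in> carrier (X q)" for k
    by (rule C.End_apply_closed[OF x]) (simp_all add: F_closed F'_closed yw)
  have "(\<Phi> x \<otimes>\<^bsub>C'.E\<^esub> \<Phi> y) n (q + n) v
      = (\<Oplus>\<^bsub>X' q\<^esub>k\<in>C.support x. \<Phi> x k (q + k) (\<Phi> y (n - k) (q + n) v))"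
    by (rule C'.End_mult_apply[OF px py fin support_conjugate[OF x] v])
  also have "\<dots> = (\<Oplus>\<^bsub>X' q\<^esub>k\<in>C.support x.
      F q (x k (q + k) (F' (q + k) (F (q + k) (y (n - k) (q + n) ?w)))))"
    by (simp add: py_apply conjugate_apply F_closed yw)
  also have "\<dots> = F q (\<Oplus>\<^bsub>X q\<^esub>k\<in>C.support x.
      x k (q + k) (F' (q + k) (F (q + k) (y (n - k) (q + n) ?w))))"
    using fin tc by (intro fwd.graded_hom_finsum[OF F_graded_hom, symmetric]) simp_all
  also have "\<dots> = F q ((x \<otimes>\<^bsub>C.E\<^esub> (round_trip \<otimes>\<^bsub>C.E\<^esub> y)) n (q + n) ?w)"
    by (simp add: C.End_mult_apply[OF x ry fin subset_refl w] ry_apply)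
  also have "\<dots> = \<Phi> (x \<otimes>\<^bsub>C.E\<^esub> round_trip \<otimes>\<^bsub>C.E\<^esub> y) n (q + n) v"
    using v x y round_trip_closed by (simp add: conjugate_apply C.E.m_assoc)
  finally show "(\<Phi> x \<otimes>\<^bsub>C'.E\<^esub> \<Phi> y) n (q + n) v
      = \<Phi> (x \<otimes>\<^bsub>C.E\<^esub> round_trip \<otimes>\<^bsub>C.E\<^esub> y) n (q + n) v" .
qed

lemma conjugate_one: "\<Phi> \<one>\<^bsub>C.E\<^esub> = C'.homogeneous 0 (\<lambda>p. \<lambda>x\<in>carrier (X' p). F p (F' p x))"
  by (intro ext) (auto simp: conjugate_def C'.homogeneous_def C.End_one_apply[where q = q for q]
      F'_closed graded_zero_def fwd.graded_hom_zero[OF F_graded_hom])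

lemma conjugate_conjugate:
  assumes y: "y \<in> carrier C.E"
  shows "conjugate X F' F (\<Phi> y) = round_trip \<otimes>\<^bsub>C.E\<^esub> y \<otimes>\<^bsub>C.E\<^esub> round_trip"
proof (intro ext)
  fix n p v
  note ry = C.E.m_closed[OF round_trip_closed y]
  note ryr = C.E.m_closed[OF ry round_trip_closed]
  show "conjugate X F' F (\<Phi> y) n p v = (round_trip \<otimes>\<^bsub>C.E\<^esub> y \<otimes>\<^bsub>C.E\<^esub> round_trip) n p v"
  proof (cases "v \<in> carrier (X p)")
    case True
    define q where "q = p - n"
    have p: "p = q + n" by (simp add: q_def)
    show ?thesis
      using True unfolding p
      by (simp add: conjugate_apply F_closed F'_closed mult_round_trip_apply[OF ry]
          round_trip_mult_apply[OF y])
  next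
    case False
    have "(round_trip \<otimes>\<^bsub>C.E\<^esub> y \<otimes>\<^bsub>C.E\<^esub> round_trip) n p \<in> extensional (carrier (X p))"
      using C.End_graded_hom[OF ryr, of n] by (auto simp: graded_hom_def linear_maps_def PiE_def)
    then show ?thesis
      using False by (simp add: conjugate_def extensional_def)
  qed
qed

lemma chain_homotopy_equivalence_sym: "chain_homotopy_equivalence R X' d' X d F' F s' s"
  by unfold_locales (simp_all add: F F' s s' homotopy homotopy')

end

sublocale chain_homotopy_equivalence \<subseteq> reverse: chain_homotopy_equivalence R X' d' X d F' F s' s
  by (rule chain_homotopy_equivalence_sym)

context chain_homotopy_equivalence
begin

lemma conjugation_homotopy:
  "differential_superring_homotopy C.E C.parity (End_diff X d) C'.E C'.parity (End_diff X' d')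
    \<Phi> S reverse.S"
proof
  show "\<Phi> \<one>\<^bsub>C.E\<^esub> = \<one>\<^bsub>C'.E\<^esub> \<oplus>\<^bsub>C'.E\<^esub> End_diff X' d' reverse.S"
    by (simp add: conjugate_one reverse.round_trip_eq)
qed (simp_all add: S_closed reverse.S_closed conjugate_closed conjugate_add conjugate_diff
    conjugate_mult round_trip_eq)

lemma conjugate_graded:
  assumes "y \<in> carrier C.E" "\<forall>k. k \<noteq> n \<longrightarrow> y k = graded_zero X k"
  shows "\<forall>k. k \<noteq> n \<longrightarrow> \<Phi> y k = graded_zero X' k"
  using support_conjugate[OF assms(1)] assms(2) by blast

end

lemma (in chain_homotopy_equivalence) cohomology_isomorphic:
  "graded_ring_isomorphic
    (End_cohomology R X d) (End_cohomology_deg R X d)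
    (End_cohomology R X' d') (End_cohomology_deg R X' d')"
proof -
  interpret H: differential_superring_homotopy_equivalence
    C.E C.parity "End_diff X d" C'.E C'.parity "End_diff X' d'" \<Phi> reverse.\<Phi> S reverse.S
    by (intro differential_superring_homotopy_equivalence.intro conjugation_homotopy
        reverse.conjugation_homotopy differential_superring_homotopy_equivalence_axioms.intro)
      (simp_all add: conjugate_conjugate reverse.conjugate_conjugate round_trip_eq
        reverse.round_trip_eq)
  obtain \<phi> where iso: "\<phi> \<in> ring_iso C.E.cohomology C'.E.cohomology"
    and \<phi>: "\<And>x. x \<in> C.E.cocycles \<Longrightarrow> \<phi> (C.E.cohomology_class x) = C'.E.cohomology_class (\<Phi> x)"
    by (rule H.cohomology_iso) blast
  have "\<phi> ` End_cohomology_deg R X d n = End_cohomology_deg R X' d' n" for n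
  proof
    show "\<phi> ` End_cohomology_deg R X d n \<subseteq> End_cohomology_deg R X' d' n"
      using conjugate_graded[of _ n] H.F.map_cocycle
      by (auto simp: C.End_cohomology_deg_eq C'.End_cohomology_deg_eq \<phi> C.E.cocycle_closed)
    show "End_cohomology_deg R X' d' n \<subseteq> \<phi> ` End_cohomology_deg R X d n"
    proof
      fix c assume "c \<in> End_cohomology_deg R X' d' n"
      then obtain z where z: "z \<in> C'.E.cocycles" "\<forall>k. k \<noteq> n \<longrightarrow> z k = graded_zero X' k"
        and c: "c = C'.E.cohomology_class z"
        by (auto simp: C'.End_cohomology_deg_eq)
      \<comment> \<open>Conjugation in the reverse direction also preserves degrees,
          so it gives a preimage of degree \<open>n\<close>.\<close>
      have "reverse.\<Phi> z \<in> C.E.cocycles" using z(1) by (rule H.G.map_cocycle)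
      moreover have "\<forall>k. k \<noteq> n \<longrightarrow> reverse.\<Phi> z k = graded_zero X k"
        using z by (intro reverse.conjugate_graded C'.E.cocycle_closed)
      moreover have "c = \<phi> (C.E.cohomology_class (reverse.\<Phi> z))"
        using z(1) calculation(1) by (simp add: c \<phi> H.forth_back_class)
      ultimately show "c \<in> \<phi> ` End_cohomology_deg R X d n"
        by (auto simp: C.End_cohomology_deg_eq)
    qed
  qed
  then show ?thesis
    using iso by (auto simp: graded_ring_isomorphic_def C.End_cohomology_eq C'.End_cohomology_eq)
qed

theorem theorem3:
  fixes A :: "('a, 'm) ring_scheme"
    and X :: "int \<Rightarrow> ('a, 'b, 'k) module_scheme" and d :: "int \<Rightarrow> 'b \<Rightarrow> 'b"
    and X' :: "int \<Rightarrow> ('a, 'c, 'l) module_scheme" and d' :: "int \<Rightarrow> 'c \<Rightarrow> 'c"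
  assumes "ring A"
    and "chain_complex A X d" and "chain_complex A X' d'"
    and "homotopy_equivalent A X d X' d'"
  shows "graded_ring_isomorphic
    (End_cohomology A X d) (End_cohomology_deg A X d)
    (End_cohomology A X' d') (End_cohomology_deg A X' d')"
proof -
  obtain F F' s s' where "F \<in> chain_maps A X d X' d'" "F' \<in> chain_maps A X' d' X d"
    "s \<in> graded_hom A X X (-1)" "s' \<in> graded_hom A X' X' (-1)"
    "\<And>p x. x \<in> carrier (X p) \<Longrightarrow>
      F' p (F p x) \<ominus>\<^bsub>X p\<^esub> x = d (p + 1) (s p x) \<oplus>\<^bsub>X p\<^esub> s (p - 1) (d p x)"
    "\<And>p x. x \<in> carrier (X' p) \<Longrightarrow>
      F p (F' p x) \<ominus>\<^bsub>X' p\<^esub> x = d' (p + 1) (s' p x) \<oplus>\<^bsub>X' p\<^esub> s' (p - 1) (d' p x)"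
    using assms(4) unfolding homotopy_equivalent_def by blast
  then have "chain_homotopy_equivalence A X d X' d' F F' s s'"
    using assms(2,3)
    by (intro chain_homotopy_equivalence.intro chain_homotopy_equivalence_axioms.intro) simp_all
  then show ?thesis by (rule chain_homotopy_equivalence.cohomology_isomorphic)
qed

end
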